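(* Let $X$ be a Cantor space, $d\ge1$, and let $\alpha$ be a free and minimal action of $\mathbb{Z}^d$ on $X$ whose mapping torus $Y_\alpha$ is isomorphic, as a fibre bundle over $\mathbb{T}^d$, to a principal solenoidal torus. Let $\Theta\in M_d(\mathbb{R})$ be skew-symmetric and $\sigma(\mathbf{m},\mathbf{n})=e^{-\pi i\,\mathbf{m}^t\Theta\mathbf{n}}$. Then there is a $\mathbb{Z}^d$-odometer $(\Omega,\mathbb{Z}^d,\beta)$ such that the twisted crossed product $C(X)\rtimes_{\alpha,\sigma}\mathbb{Z}^d$ is isomorphic as a $C^*$-algebra to the twisted crossed product $C(\Omega)\rtimes_{\beta,\sigma}\mathbb{Z}^d$. In particular (for $\Theta=0$) the $C^*$-algebra $C(X)\rtimes_\alpha\mathbb{Z}^d$ is isomorphic to a $\mathbb{Z}^d$-odometer crossed product.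
   Context: An action is minimal if every orbit is dense. The mapping torus $Y_\alpha=X\times_{\mathbb{Z}^d}\mathbb{R}^d$ is the quotient of $X\times\mathbb{R}^d$ by $(x,\mathbf{u})\sim(\alpha(-\mathbf{n})(x),\mathbf{u}+\mathbf{n})$, $\mathbf{n}\in\mathbb{Z}^d$; it is a fibre bundle over $\mathbb{T}^d=\mathbb{R}^d/\mathbb{Z}^d$ with fibre $X$. A principal solenoidal torus is a space $Y=\varprojlim_j Y_j$, $j\ge1$, where each $Y_j=\mathbb{T}^d$ and the connecting maps $f_{j+1}\colon Y_{j+1}\to Y_j$ are (finite) Galois covers of degree greater than one (Galois: the group of deck transformations acts transitively on each fibre). The induced covers $p_j\colon Y_j\to Y_1=\mathbb{T}^d$ are finite Galois covers with deck group $G_j=\mathbb{Z}^d/\Gamma_j$, a quotient of $\pi_1(Y_1)\cong\mathbb{Z}^d$, and $Y\to Y_1=\mathbb{T}^d$ is a principal bundle with structure group $\Omega=\varprojlim_j G_j$; this is its fibre bundle structure over the torus. The associated $\mathbb{Z}^d$-odometer is $(\Omega,\mathbb{Z}^d,\beta)$ where $\beta$ is the action of $\mathbb{Z}^d$ on $\Omega$ given by coset translation on each $G_j=\mathbb{Z}^d/\Gamma_j$. *)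

theory Defs
  imports "HOL-Analysis.Analysis" "HOL-Algebra.QuotRing" "HOL-Algebra.Module"
begin

section \<open>Topological preliminaries\<close>

definition cantor_space :: "'a topology \<Rightarrow> bool" where
  "cantor_space X \<longleftrightarrow>
     X homeomorphic_space product_topology (\<lambda>_::nat. discrete_topology (UNIV :: bool set)) UNIV"

definition quotient_topology :: "'a topology \<Rightarrow> ('a \<times> 'a) set \<Rightarrow> 'a set topology" where
  "quotient_topology X r = topology (\<lambda>U. U \<subseteq> topspace X // r \<and> openin X (\<Union>U))"

text \<open>The subset test above is the usual quotient topology: for an equivalence relation, the
  preimage of a set \<open>U\<close> of classes under the quotient map is the union of \<open>U\<close>.\<close>

lemma openin_quotient_topology:
  assumes "equiv (topspace X) r"
  shows "openin (quotient_topology X r) U \<longleftrightarrow> U \<subseteq> topspace X // r \<and> openin X (\<Union>U)"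
proof -
  have "istopology (\<lambda>U. U \<subseteq> topspace X // r \<and> openin X (\<Union>U))"
    unfolding istopology_def
  proof (intro conjI allI impI)
    fix S T assume S: "S \<subseteq> topspace X // r \<and> openin X (\<Union>S)"
      and T: "T \<subseteq> topspace X // r \<and> openin X (\<Union>T)"
    have "A = B" if "x \<in> A" "x \<in> B" "A \<in> S" "B \<in> T" for x A B
      using that S T quotient_disj[OF assms, of A B] by blast
    then have "\<Union>(S \<inter> T) = \<Union>S \<inter> \<Union>T"
      by blast
    then show "openin X (\<Union>(S \<inter> T))"
      using S T by (simp add: openin_Int)
    show "S \<inter> T \<subseteq> topspace X // r"
      using S by blast
  next
    fix K assume K: "\<forall>S\<in>K. S \<subseteq> topspace X // r \<and> openin X (\<Union>S)"
    have "\<Union>(\<Union>K) = \<Union>((\<lambda>S. \<Union>S) ` K)"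
      by blast
    moreover have "openin X (\<Union>((\<lambda>S. \<Union>S) ` K))"
      using K by (intro openin_Union) blast
    ultimately show "openin X (\<Union>(\<Union>K))"
      by simp
    show "\<Union>K \<subseteq> topspace X // r"
      using K by blast
  qed
  then show ?thesis
    by (simp add: quotient_topology_def topology_inverse')
qed

definition inverse_limit :: "(nat \<Rightarrow> 'a topology) \<Rightarrow> (nat \<Rightarrow> 'a \<Rightarrow> 'a) \<Rightarrow> (nat \<Rightarrow> 'a) topology" where
  "inverse_limit Y f = subtopology (product_topology Y UNIV) {y. \<forall>j. f j (y (Suc j)) = y j}"

definition covering_map :: "'a topology \<Rightarrow> 'b topology \<Rightarrow> ('a \<Rightarrow> 'b) \<Rightarrow> bool" where
  "covering_map E B p \<longleftrightarrow>
     continuous_map E B p \<and> p ` topspace E = topspace B \<and>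
     (\<forall>b\<in>topspace B. \<exists>V. openin B V \<and> b \<in> V \<and>
        (\<exists>\<U>. \<Union>\<U> = {e \<in> topspace E. p e \<in> V} \<and> pairwise disjnt \<U> \<and>
             (\<forall>U\<in>\<U>. openin E U \<and> homeomorphic_map (subtopology E U) (subtopology B V) p)))"

definition deck_transformations :: "'a topology \<Rightarrow> ('a \<Rightarrow> 'b) \<Rightarrow> ('a \<Rightarrow> 'a) set" where
  "deck_transformations E p = {g. homeomorphic_map E E g \<and> (\<forall>e\<in>topspace E. p (g e) = p e)}"

definition galois_cover :: "'a topology \<Rightarrow> 'b topology \<Rightarrow> ('a \<Rightarrow> 'b) \<Rightarrow> bool" where
  "galois_cover E B p \<longleftrightarrow> covering_map E B p \<and>
     (\<forall>x\<in>topspace E. \<forall>y\<in>topspace E. p x = p y \<longrightarrow> (\<exists>g\<in>deck_transformations E p. g x = y))"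

definition finite_nontrivial_galois_cover :: "'a topology \<Rightarrow> 'b topology \<Rightarrow> ('a \<Rightarrow> 'b) \<Rightarrow> bool" where
  "finite_nontrivial_galois_cover E B p \<longleftrightarrow> galois_cover E B p \<and>
     (\<forall>b\<in>topspace B. finite {e \<in> topspace E. p e = b} \<and> card {e \<in> topspace E. p e = b} > 1)"

text \<open>Isomorphism of bundles \<open>p : E \<rightarrow> B\<close> and \<open>q : F \<rightarrow> B\<close> over the same base, covering the
  identity of \<open>B\<close>.\<close>

definition bundle_isomorphic ::
    "'a topology \<Rightarrow> ('a \<Rightarrow> 'c) \<Rightarrow> 'b topology \<Rightarrow> ('b \<Rightarrow> 'c) \<Rightarrow> bool" where
  "bundle_isomorphic E p F q \<longleftrightarrow>
     (\<exists>h. homeomorphic_map E F h \<and> (\<forall>e\<in>topspace E. q (h e) = p e))"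


section \<open>Actions of \<open>\<int>\<^sup>d\<close>\<close>

definition rvec :: "int ^ 'd \<Rightarrow> real ^ 'd" where
  "rvec n = (\<chi> i. real_of_int (n $ i))"

definition zd_action :: "'x topology \<Rightarrow> (int ^ 'd \<Rightarrow> 'x \<Rightarrow> 'x) \<Rightarrow> bool" where
  "zd_action X \<alpha> \<longleftrightarrow>
     (\<forall>n. homeomorphic_map X X (\<alpha> n)) \<and>
     (\<forall>x\<in>topspace X. \<alpha> 0 x = x) \<and>
     (\<forall>m n. \<forall>x\<in>topspace X. \<alpha> (m + n) x = \<alpha> m (\<alpha> n x))"

definition free_action :: "'x topology \<Rightarrow> (int ^ 'd \<Rightarrow> 'x \<Rightarrow> 'x) \<Rightarrow> bool" where
  "free_action X \<alpha> \<longleftrightarrow> (\<forall>n. \<forall>x\<in>topspace X. \<alpha> n x = x \<longrightarrow> n = 0)"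

definition minimal_action :: "'x topology \<Rightarrow> (int ^ 'd \<Rightarrow> 'x \<Rightarrow> 'x) \<Rightarrow> bool" where
  "minimal_action X \<alpha> \<longleftrightarrow> (\<forall>x\<in>topspace X. X closure_of (range (\<lambda>n. \<alpha> n x)) = topspace X)"


section \<open>Tori, mapping tori and solenoidal tori\<close>

definition torus_rel :: "((real ^ 'd) \<times> (real ^ 'd)) set" where
  "torus_rel = {(u, v). \<exists>n. v = u + rvec n}"

definition torus :: "(real ^ 'd) set topology" where
  "torus = quotient_topology euclidean torus_rel"

definition mapping_torus_rel ::
    "'x topology \<Rightarrow> (int ^ 'd \<Rightarrow> 'x \<Rightarrow> 'x) \<Rightarrow> (('x \<times> (real ^ 'd)) \<times> ('x \<times> (real ^ 'd))) set" where
  "mapping_torus_rel X \<alpha> = {((x, u), (y, v)). x \<in> topspace X \<and> (\<exists>n. y = \<alpha> (- n) x \<and> v = u + rvec n)}"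

definition mapping_torus ::
    "'x topology \<Rightarrow> (int ^ 'd \<Rightarrow> 'x \<Rightarrow> 'x) \<Rightarrow> ('x \<times> (real ^ 'd)) set topology" where
  "mapping_torus X \<alpha> = quotient_topology (prod_topology X euclidean) (mapping_torus_rel X \<alpha>)"

definition mapping_torus_proj :: "('x \<times> (real ^ 'd)) set \<Rightarrow> (real ^ 'd) set" where
  "mapping_torus_proj C = (\<Union>(x, u)\<in>C. torus_rel `` {u})"

text \<open>The tower is indexed from \<open>0\<close>: \<open>f j\<close> is the connecting map from level \<open>j + 1\<close> to level \<open>j\<close>,
  and level \<open>0\<close> is the base torus.\<close>

definition solenoidal_tower :: "(nat \<Rightarrow> (real ^ 'd) set \<Rightarrow> (real ^ 'd) set) \<Rightarrow> bool" where
  "solenoidal_tower f \<longleftrightarrow> (\<forall>j. finite_nontrivial_galois_cover torus torus (f j))"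

definition solenoidal_torus ::
    "(nat \<Rightarrow> (real ^ 'd) set \<Rightarrow> (real ^ 'd) set) \<Rightarrow> (nat \<Rightarrow> (real ^ 'd) set) topology" where
  "solenoidal_torus f = inverse_limit (\<lambda>_. torus) f"

definition solenoidal_torus_proj :: "(nat \<Rightarrow> (real ^ 'd) set) \<Rightarrow> (real ^ 'd) set" where
  "solenoidal_torus_proj y = y 0"

lemma equiv_torus_rel: "equiv UNIV (torus_rel :: ((real ^ 'd) \<times> (real ^ 'd)) set)"
proof (rule equivI)
  show "refl (torus_rel :: ((real ^ 'd) \<times> (real ^ 'd)) set)"
    by (auto simp: refl_on_def torus_rel_def rvec_def vec_eq_iff intro!: exI[of _ 0])
  show "sym (torus_rel :: ((real ^ 'd) \<times> (real ^ 'd)) set)"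
  proof (rule symI)
    fix u v :: "real ^ 'd" assume "(u, v) \<in> torus_rel"
    then obtain n where "v = u + rvec n" by (auto simp: torus_rel_def)
    then have "u = v + rvec (- n)" by (simp add: rvec_def vec_eq_iff)
    then show "(v, u) \<in> torus_rel" by (auto simp: torus_rel_def)
  qed
  show "trans (torus_rel :: ((real ^ 'd) \<times> (real ^ 'd)) set)"
  proof (rule transI)
    fix u v w :: "real ^ 'd" assume "(u, v) \<in> torus_rel" "(v, w) \<in> torus_rel"
    then obtain m n where "v = u + rvec m" "w = v + rvec n" by (auto simp: torus_rel_def)
    then have "w = u + rvec (m + n)" by (simp add: rvec_def vec_eq_iff)
    then show "(u, w) \<in> torus_rel" by (auto simp: torus_rel_def)
  qed
qed auto

lemma equiv_mapping_torus_rel: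
  fixes \<alpha> :: "int ^ 'd \<Rightarrow> 'x \<Rightarrow> 'x"
  assumes "zd_action X \<alpha>"
  shows "equiv (topspace (prod_topology X euclidean)) (mapping_torus_rel X \<alpha>)"
proof -
  have in_X: "\<alpha> n x \<in> topspace X" if "x \<in> topspace X" for n x
    using assms that homeomorphic_imp_surjective_map by (fastforce simp: zd_action_def)
  have zero: "\<alpha> 0 x = x" and add: "\<alpha> (m + n) x = \<alpha> m (\<alpha> n x)" if "x \<in> topspace X" for m n x
    using assms that by (auto simp: zd_action_def)
  show ?thesis
  proof (rule equivI)
    show "mapping_torus_rel X \<alpha>
        \<subseteq> topspace (prod_topology X euclidean) \<times> topspace (prod_topology X euclidean)"
      by (auto simp: mapping_torus_rel_def in_X)
    show "refl_on (topspace (prod_topology X euclidean)) (mapping_torus_rel X \<alpha>)"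
      by (auto simp: refl_on_def mapping_torus_rel_def in_X zero rvec_def vec_eq_iff
          intro!: exI[of _ 0])
    show "sym (mapping_torus_rel X \<alpha>)"
    proof (rule symI, clarify)
      fix x y and u v :: "real ^ 'd"
      assume "((x, u), (y, v)) \<in> mapping_torus_rel X \<alpha>"
      then obtain n where n: "x \<in> topspace X" "y = \<alpha> (- n) x" "v = u + rvec n"
        by (auto simp: mapping_torus_rel_def)
      then have "y \<in> topspace X" "x = \<alpha> (- (- n)) y" "u = v + rvec (- n)"
        using add[of x n "- n"] zero[of x] in_X by (simp_all add: rvec_def vec_eq_iff)
      then have "\<exists>k. x = \<alpha> (- k) y \<and> u = v + rvec k"
        by (intro exI[of _ "- n"] conjI)
      then show "((y, v), (x, u)) \<in> mapping_torus_rel X \<alpha>"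
        using \<open>y \<in> topspace X\<close> unfolding mapping_torus_rel_def by simp
    qed
    show "trans (mapping_torus_rel X \<alpha>)"
    proof (rule transI, clarify)
      fix x y z and u v w :: "real ^ 'd"
      assume "((x, u), (y, v)) \<in> mapping_torus_rel X \<alpha>" "((y, v), (z, w)) \<in> mapping_torus_rel X \<alpha>"
      then obtain m n where mn: "x \<in> topspace X" "y = \<alpha> (- m) x" "v = u + rvec m"
          "z = \<alpha> (- n) y" "w = v + rvec n"
        by (auto simp: mapping_torus_rel_def)
      have "- (m + n) = - n + - m"
        by simp
      then have "z = \<alpha> (- (m + n)) x"
        using add[of x "- n" "- m"] mn by metis
      moreover have "w = u + rvec (m + n)"
        using mn by (simp add: rvec_def vec_eq_iff)
      ultimately have "\<exists>k. z = \<alpha> (- k) x \<and> w = u + rvec k"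
        by (intro exI[of _ "m + n"] conjI)
      then show "((x, u), (z, w)) \<in> mapping_torus_rel X \<alpha>"
        using mn(1) unfolding mapping_torus_rel_def by simp
    qed
  qed
qed


section \<open>Odometers\<close>

definition Zd :: "(int ^ 'd) monoid" where
  "Zd = \<lparr>carrier = UNIV, mult = (+), one = 0\<rparr>"

text \<open>Strictness of the inclusions corresponds to the connecting covers having degree greater than
  one; level \<open>0\<close> is the base torus, hence \<open>\<Gamma> 0 = \<int>\<^sup>d\<close>.\<close>

definition odometer_tower :: "(nat \<Rightarrow> (int ^ 'd) set) \<Rightarrow> bool" where
  "odometer_tower \<Gamma> \<longleftrightarrow> \<Gamma> 0 = UNIV \<and>
     (\<forall>j. subgroup (\<Gamma> j) Zd \<and> finite (rcosets\<^bsub>Zd\<^esub> \<Gamma> j) \<and> \<Gamma> (Suc j) \<subset> \<Gamma> j)"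

definition odometer_space :: "(nat \<Rightarrow> (int ^ 'd) set) \<Rightarrow> (nat \<Rightarrow> (int ^ 'd) set) topology" where
  "odometer_space \<Gamma> =
     inverse_limit (\<lambda>j. discrete_topology (rcosets\<^bsub>Zd\<^esub> \<Gamma> j))
       (\<lambda>j C. \<Union>c\<in>C. \<Gamma> j #>\<^bsub>Zd\<^esub> c)"

definition odometer_action ::
    "int ^ 'd \<Rightarrow> (nat \<Rightarrow> (int ^ 'd) set) \<Rightarrow> (nat \<Rightarrow> (int ^ 'd) set)" where
  "odometer_action n \<omega> = (\<lambda>j. n <#\<^bsub>Zd\<^esub> \<omega> j)"


section \<open>Involutive algebras, C*-completions and isomorphism\<close>

record 'a star_algebra = "(complex, 'a) module" +
  adj :: "'a \<Rightarrow> 'a"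

record 'a cstar_algebra = "'a star_algebra" +
  cnorm :: "'a \<Rightarrow> real"

definition cstar_seminorm :: "('a, 'm) star_algebra_scheme \<Rightarrow> ('a \<Rightarrow> real) \<Rightarrow> bool" where
  "cstar_seminorm A p \<longleftrightarrow>
     (\<forall>a\<in>carrier A. p a \<ge> 0) \<and>
     (\<forall>a\<in>carrier A. \<forall>b\<in>carrier A. p (a \<oplus>\<^bsub>A\<^esub> b) \<le> p a + p b) \<and>
     (\<forall>c. \<forall>a\<in>carrier A. p (c \<odot>\<^bsub>A\<^esub> a) = cmod c * p a) \<and>
     (\<forall>a\<in>carrier A. \<forall>b\<in>carrier A. p (a \<otimes>\<^bsub>A\<^esub> b) \<le> p a * p b) \<and>
     (\<forall>a\<in>carrier A. p (adj A a \<otimes>\<^bsub>A\<^esub> a) = (p a)\<^sup>2)"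

text \<open>The norm of the enveloping C*-algebra of a *-algebra \<open>A\<close> normed by \<open>\<nu>\<close>. The seminorms
  \<open>a \<mapsto> \<parallel>\<pi> a\<parallel>\<close> for \<open>\<nu>\<close>-contractive *-homomorphisms \<open>\<pi>\<close> into C*-algebras are exactly the C*-seminorms
  dominated by \<open>\<nu>\<close>, so quantifying over the latter avoids quantifying over all C*-algebras.\<close>

definition enveloping_norm ::
    "('a, 'm) star_algebra_scheme \<Rightarrow> ('a \<Rightarrow> real) \<Rightarrow> 'a \<Rightarrow> real" where
  "enveloping_norm A \<nu> a =
     (SUP p\<in>{p. cstar_seminorm A p \<and> (\<forall>b\<in>carrier A. p b \<le> \<nu> b)}. p a)"

definition cauchy_sequences ::
    "('a, 'm) star_algebra_scheme \<Rightarrow> ('a \<Rightarrow> real) \<Rightarrow> (nat \<Rightarrow> 'a) set" where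
  "cauchy_sequences A N = {a. range a \<subseteq> carrier A \<and>
     (\<forall>e>0. \<exists>K. \<forall>k\<ge>K. \<forall>l\<ge>K. N (a k \<oplus>\<^bsub>A\<^esub> (- 1) \<odot>\<^bsub>A\<^esub> a l) < e)}"

definition null_difference ::
    "('a, 'm) star_algebra_scheme \<Rightarrow> ('a \<Rightarrow> real) \<Rightarrow> ((nat \<Rightarrow> 'a) \<times> (nat \<Rightarrow> 'a)) set" where
  "null_difference A N = {(a, b). a \<in> cauchy_sequences A N \<and> b \<in> cauchy_sequences A N \<and>
     (\<lambda>k. N (a k \<oplus>\<^bsub>A\<^esub> (- 1) \<odot>\<^bsub>A\<^esub> b k)) \<longlonglongrightarrow> 0}"

text \<open>The Hausdorff completion: Cauchy sequences modulo null sequences, with termwise operations.\<close>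

definition completion ::
    "('a, 'm) star_algebra_scheme \<Rightarrow> ('a \<Rightarrow> real) \<Rightarrow> (nat \<Rightarrow> 'a) set cstar_algebra" where
  "completion A N =
     (let r = null_difference A N in
      \<lparr>carrier = cauchy_sequences A N // r,
       mult = (\<lambda>S T. \<Union>a\<in>S. \<Union>b\<in>T. r `` {\<lambda>k. a k \<otimes>\<^bsub>A\<^esub> b k}),
       one = r `` {\<lambda>k. \<one>\<^bsub>A\<^esub>},
       zero = r `` {\<lambda>k. \<zero>\<^bsub>A\<^esub>},
       add = (\<lambda>S T. \<Union>a\<in>S. \<Union>b\<in>T. r `` {\<lambda>k. a k \<oplus>\<^bsub>A\<^esub> b k}),
       smult = (\<lambda>c S. \<Union>a\<in>S. r `` {\<lambda>k. c \<odot>\<^bsub>A\<^esub> a k}),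
       adj = (\<lambda>S. \<Union>a\<in>S. r `` {\<lambda>k. adj A (a k)}),
       cnorm = (\<lambda>S. lim (\<lambda>k. N ((SOME a. a \<in> S) k)))\<rparr>)"

definition enveloping_cstar_algebra ::
    "('a, 'm) star_algebra_scheme \<Rightarrow> ('a \<Rightarrow> real) \<Rightarrow> (nat \<Rightarrow> 'a) set cstar_algebra" where
  "enveloping_cstar_algebra A \<nu> = completion A (enveloping_norm A \<nu>)"

text \<open>Unital *-isomorphism; between C*-algebras the norm condition is automatic.\<close>

definition cstar_isomorphic ::
    "('a, 'm) cstar_algebra_scheme \<Rightarrow> ('b, 'n) cstar_algebra_scheme \<Rightarrow> bool" where
  "cstar_isomorphic A B \<longleftrightarrow>
     (\<exists>h \<in> ring_iso A B.
        (\<forall>c. \<forall>a\<in>carrier A. h (c \<odot>\<^bsub>A\<^esub> a) = c \<odot>\<^bsub>B\<^esub> h a) \<and>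
        (\<forall>a\<in>carrier A. h (adj A a) = adj B (h a)) \<and>
        (\<forall>a\<in>carrier A. cnorm B (h a) = cnorm A a))"


section \<open>Twisted crossed products\<close>

text \<open>\<open>C(X)\<close>; functions are set to \<open>0\<close> off the carrier of \<open>X\<close> so that equality is extensional.\<close>

definition cfun :: "'x topology \<Rightarrow> ('x \<Rightarrow> complex) set" where
  "cfun X = {f. continuous_map X euclidean f \<and> (\<forall>x. x \<notin> topspace X \<longrightarrow> f x = 0)}"

definition cfun_action ::
    "'x topology \<Rightarrow> (int ^ 'd \<Rightarrow> 'x \<Rightarrow> 'x) \<Rightarrow> int ^ 'd \<Rightarrow> ('x \<Rightarrow> complex) \<Rightarrow> ('x \<Rightarrow> complex)" where
  "cfun_action X \<alpha> n f = (\<lambda>x. if x \<in> topspace X then f (\<alpha> (- n) x) else 0)"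

text \<open>A finitely supported \<open>a : \<int>\<^sup>d \<rightarrow> C(X)\<close> stands for the sum of \<open>a n \<cdot> u\<^sub>n\<close> over all \<open>n\<close>, where the \<open>u\<^sub>n\<close> are unitaries
  with \<open>u\<^sub>n f u\<^sub>n* = f \<circ> \<alpha> (- n)\<close> and \<open>u\<^sub>m u\<^sub>n = \<sigma> m n \<cdot> u\<^sub>m\<^sub>+\<^sub>n\<close> (for a circle-valued 2-cocycle \<open>\<sigma>\<close> with
  \<open>\<sigma> 0 n = \<sigma> n 0 = 1\<close>); this dictates the product and the involution below.\<close>

definition twisted_convolution_algebra ::
    "'x topology \<Rightarrow> (int ^ 'd \<Rightarrow> 'x \<Rightarrow> 'x) \<Rightarrow> (int ^ 'd \<Rightarrow> int ^ 'd \<Rightarrow> complex) \<Rightarrow>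
     (int ^ 'd \<Rightarrow> 'x \<Rightarrow> complex) star_algebra" where
  "twisted_convolution_algebra X \<alpha> \<sigma> =
     \<lparr>carrier = {a. (\<forall>n. a n \<in> cfun X) \<and> finite {n. a n \<noteq> (\<lambda>_. 0)}},
      mult = (\<lambda>a b n x. \<Sum>m | a m \<noteq> (\<lambda>_. 0).
                \<sigma> m (n - m) * a m x * cfun_action X \<alpha> m (b (n - m)) x),
      one = (\<lambda>n x. if n = 0 \<and> x \<in> topspace X then 1 else 0),
      zero = (\<lambda>n x. 0),
      add = (\<lambda>a b n x. a n x + b n x),
      smult = (\<lambda>c a n x. c * a n x),
      adj = (\<lambda>a n x. cnj (\<sigma> (- n) n) * cfun_action X \<alpha> n (\<lambda>y. cnj (a (- n) y)) x)\<rparr>"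

definition l1_norm :: "'x topology \<Rightarrow> (int ^ 'd \<Rightarrow> 'x \<Rightarrow> complex) \<Rightarrow> real" where
  "l1_norm X a = (\<Sum>n | a n \<noteq> (\<lambda>_. 0). SUP x\<in>topspace X. cmod (a n x))"

definition twisted_crossed_product ::
    "'x topology \<Rightarrow> (int ^ 'd \<Rightarrow> 'x \<Rightarrow> 'x) \<Rightarrow> (int ^ 'd \<Rightarrow> int ^ 'd \<Rightarrow> complex) \<Rightarrow>
     (nat \<Rightarrow> int ^ 'd \<Rightarrow> 'x \<Rightarrow> complex) set cstar_algebra" where
  "twisted_crossed_product X \<alpha> \<sigma> =
     enveloping_cstar_algebra (twisted_convolution_algebra X \<alpha> \<sigma>) (l1_norm X)"

definition crossed_product ::
    "'x topology \<Rightarrow> (int ^ 'd \<Rightarrow> 'x \<Rightarrow> 'x) \<Rightarrow>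
     (nat \<Rightarrow> int ^ 'd \<Rightarrow> 'x \<Rightarrow> complex) set cstar_algebra" where
  "crossed_product X \<alpha> = twisted_crossed_product X \<alpha> (\<lambda>m n. 1)"

definition theta_cocycle :: "real ^ 'd ^ 'd \<Rightarrow> int ^ 'd \<Rightarrow> int ^ 'd \<Rightarrow> complex" where
  "theta_cocycle \<Theta> m n = exp (- (complex_of_real pi * \<i> * complex_of_real (rvec m \<bullet> (\<Theta> *v rvec n))))"

end

theory Submission
  imports Defs
begin

text \<open>Let \<open>h\<close> be the bundle isomorphism and \<open>\<phi> j x\<close> the \<open>j\<close>-th coordinate of \<open>h [x, 0]\<close>, which takes finitely
  many values. Since \<open>u \<mapsto> h [x, u]\<close> lifts \<open>u \<mapsto> [u]\<close> and \<open>[x, n] = [\<alpha> n x, 0]\<close>, uniqueness of lifts shows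
  that \<open>\<phi> j x\<close> determines \<open>\<phi> j (\<alpha> n x)\<close>: the level sets of \<open>\<phi> j\<close> form a finite clopen partition permuted by
  the action. These partitions refine each other and separate points, so recording the times at which
  the orbit of a base point \<open>x\<^sub>0\<close> visits the piece of \<open>x\<close> is a conjugacy from \<open>X\<close> to the odometer of the
  stabilisers of the pieces of \<open>x\<^sub>0\<close>. A conjugacy of actions transports the twisted convolution algebra
  isometrically, hence also its enveloping C*-algebra, for any twist \<open>\<sigma>\<close>.\<close>

section \<open>Quotients, tori and unique lifting\<close>

lemma topspace_quotient_topology:
  assumes "equiv (topspace X) r"
  shows "topspace (quotient_topology X r) = topspace X // r"
proof -
  have "openin (quotient_topology X r) (topspace X // r)"
    by (simp add: openin_quotient_topology[OF assms] Union_quotient[OF assms])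
  moreover have "topspace (quotient_topology X r) \<subseteq> topspace X // r"
    using openin_quotient_topology[OF assms] openin_topspace by blast
  ultimately show ?thesis
    by (meson openin_subset subset_antisym)
qed

text \<open>A class in \<open>U\<close> is the class of each of its members, so the preimage of
  \<open>U\<close> under the quotient map is \<open>\<Union>U\<close>.\<close>

lemma continuous_map_quotient_topology:
  assumes "equiv (topspace X) r"
  shows "continuous_map X (quotient_topology X r) (\<lambda>x. r `` {x})"
  unfolding continuous_map_def
proof (intro conjI allI impI)
  show "(\<lambda>x. r `` {x}) \<in> topspace X \<rightarrow> topspace (quotient_topology X r)"
    by (simp add: topspace_quotient_topology[OF assms] quotientI)
  fix U assume U: "openin (quotient_topology X r) U"
  have "{x \<in> topspace X. r `` {x} \<in> U} = \<Union>U"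
  proof (intro subset_antisym subsetI)
    fix x assume "x \<in> {x \<in> topspace X. r `` {x} \<in> U}"
    then show "x \<in> \<Union>U"
      using equiv_class_self[OF assms] by blast
  next
    fix x assume "x \<in> \<Union>U"
    then obtain C where C: "C \<in> U" "x \<in> C" by blast
    then have "C \<in> topspace X // r"
      using U openin_quotient_topology[OF assms] by blast
    then have "C = r `` {x}" "x \<in> topspace X"
      using C in_quotient_imp_subset[OF assms] Image_singleton_iff
      by (metis assms equiv_class_eq quotientE, blast)
    then show "x \<in> {x \<in> topspace X. r `` {x} \<in> U}"
      using C by simp
  qed
  then show "openin X {x \<in> topspace X. r `` {x} \<in> U}"
    using U openin_quotient_topology[OF assms] by auto
qed

section \<open>The torus as a Hausdorff quotient of Euclidean space\<close>

lemma topspace_torus: "topspace torus = UNIV // torus_rel"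
  using topspace_quotient_topology[of euclidean torus_rel] equiv_torus_rel by (simp add: torus_def)

lemma torus_class_eq_iff: "torus_rel `` {u} = torus_rel `` {v} \<longleftrightarrow> (\<exists>n. v = u + rvec n)"
  using eq_equiv_class_iff[OF equiv_torus_rel, of u v] by (simp add: torus_rel_def)

lemma closed_range_rvec: "closed (range (rvec :: int ^ 'd \<Rightarrow> real ^ 'd))"
proof -
  have "range (rvec :: int ^ 'd \<Rightarrow> real ^ 'd) = {x. \<forall>i. x $ i \<in> \<int>}"
  proof (intro subset_antisym subsetI)
    fix x :: "real ^ 'd" assume "x \<in> {x. \<forall>i. x $ i \<in> \<int>}"
    then have "x = rvec (\<chi> i. \<lfloor>x $ i\<rfloor>)"
      by (simp add: rvec_def vec_eq_iff)
    then show "x \<in> range rvec" by blast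
  qed (auto simp: rvec_def)
  also have "\<dots> = (\<Inter>i. (\<lambda>x. x $ i) -` \<int>)"
    by auto
  also have "closed \<dots>"
    by (intro closed_INT ballI continuous_closed_vimage) auto
  finally show ?thesis .
qed

text \<open>For distinct classes of \<open>u\<close> and \<open>v\<close> the vector
  \<open>v - u\<close> lies outside the closed lattice, so some \<open>e\<close>-ball around it
  misses the lattice. The balls of radius \<open>e/2\<close> around \<open>u\<close> and
  \<open>v\<close> then contain no equivalent points: such a pair would differ by a lattice vector
  inside that \<open>e\<close>-ball.\<close>

lemma Hausdorff_space_torus: "Hausdorff_space (torus :: (real ^ 'd) set topology)"
  unfolding Hausdorff_space_def
proof (intro allI impI, elim conjE)
  fix A B :: "(real ^ 'd) set"
  assume AB: "A \<in> topspace torus" "B \<in> topspace torus" "A \<noteq> B"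
  then obtain u v where uv: "A = torus_rel `` {u}" "B = torus_rel `` {v}"
    by (auto simp: topspace_torus elim!: quotientE)
  then have "v - u \<in> - range rvec"
    using AB(3) torus_class_eq_iff[of u v] by (auto simp: algebra_simps)
  moreover have "open (- range (rvec :: int ^ 'd \<Rightarrow> real ^ 'd))"
    using closed_range_rvec by (rule open_Compl)
  ultimately obtain e where e: "e > 0" "ball (v - u) e \<subseteq> - range rvec"
    by (meson openE)
  define N where "N w = (\<lambda>x. torus_rel `` {x}) ` ball w (e/2)" for w :: "real ^ 'd"
  have "openin torus (N w)" for w
  proof -
    \<comment> \<open>The saturation of a ball is the union of its lattice translates, hence
      open.\<close>
    have "\<Union>(N w) = (\<Union>n. (\<lambda>x. rvec n + x) ` ball w (e/2))"
      unfolding N_def torus_rel_def by (auto simp: add.commute)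
    moreover have "open \<dots>"
      by (intro open_UN ballI open_translation) auto
    ultimately have "open (\<Union>(N w))"
      by simp
    moreover have "equiv (topspace euclidean) (torus_rel :: ((real ^ 'd) \<times> (real ^ 'd)) set)"
      by (simp add: equiv_torus_rel)
    ultimately show ?thesis
      unfolding torus_def by (auto simp: openin_quotient_topology N_def intro!: quotientI)
  qed
  moreover have "A \<in> N u" "B \<in> N v"
    using uv e(1) by (auto simp: N_def)
  moreover have "disjnt (N u) (N v)"
    unfolding disjnt_iff N_def
  proof (intro allI notI, elim conjE imageE)
    fix C x y assume C: "C = torus_rel `` {x}" "C = torus_rel `` {y}"
      and xy: "x \<in> ball u (e/2)" "y \<in> ball v (e/2)"
    then obtain n where n: "y = x + rvec n"
      using torus_class_eq_iff[of x y] by metis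
    have "dist (v - u) (y - x) = norm ((v - y) + (x - u))"
      by (simp add: dist_norm algebra_simps)
    also have "\<dots> \<le> norm (v - y) + norm (x - u)"
      by (rule norm_triangle_ineq)
    also have "\<dots> < e"
      using xy by (simp add: dist_norm norm_minus_commute)
    finally have "rvec n \<in> ball (v - u) e"
      using n by simp
    then show False
      using e(2) by blast
  qed
  ultimately show "\<exists>U V. openin torus U \<and> openin torus V \<and> A \<in> U \<and> B \<in> V \<and> disjnt U V"
    by blast
qed

text \<open>The set where the lifts agree is closed because \<open>E\<close> is Hausdorff, and open
  because \<open>p\<close> is injective on each sheet over an evenly covered neighbourhood. As
  \<open>W\<close> is connected and \<open>a\<close> lies in this set, it is all of
  \<open>W\<close>.\<close>

lemma covering_map_unique_lift:
  assumes cov: "covering_map E B p" and E: "Hausdorff_space E" and W: "connected_space W"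
    and g: "continuous_map W E g" and g': "continuous_map W E g'"
    and lift: "\<And>w. w \<in> topspace W \<Longrightarrow> p (g w) = p (g' w)"
    and a: "a \<in> topspace W" "g a = g' a" and b: "b \<in> topspace W"
  shows "g b = g' b"
proof -
  define S where "S = {w \<in> topspace W. g w = g' w}"
  have "closedin W S"
    unfolding S_def using E g g' by (rule closedin_continuous_maps_eq)
  moreover have "openin W S"
    unfolding openin_subopen[of W S]
  proof
    fix w assume "w \<in> S"
    then have w: "w \<in> topspace W" "g w = g' w"
      by (auto simp: S_def)
    have gw: "g w \<in> topspace E"
      using g w(1) by (auto simp: continuous_map_def)
    then have pgw: "p (g w) \<in> topspace B"
      using cov by (auto simp: covering_map_def)
    have "\<forall>b\<in>topspace B. \<exists>V. openin B V \<and> b \<in> V \<and>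
        (\<exists>\<U>. \<Union>\<U> = {e \<in> topspace E. p e \<in> V} \<and> pairwise disjnt \<U> \<and>
             (\<forall>U\<in>\<U>. openin E U \<and> homeomorphic_map (subtopology E U) (subtopology B V) p))"
      using cov unfolding covering_map_def by (elim conjE)
    from bspec[OF this pgw] obtain V \<U> where V: "p (g w) \<in> V" "\<Union>\<U> = {e \<in> topspace E. p e \<in> V}"
      and \<U>: "\<forall>U\<in>\<U>. openin E U \<and> homeomorphic_map (subtopology E U) (subtopology B V) p"
      by (elim exE conjE, intro that)
    have "g w \<in> \<Union>\<U>"
      unfolding V(2) using gw V(1) by simp
    then obtain U where U: "U \<in> \<U>" "g w \<in> U"
      by (rule UnionE)
    note \<U> = bspec[OF \<U>]
    have "topspace (subtopology E U) = U"
      using \<U>[OF U(1)] openin_subset by (auto simp: topspace_subtopology)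
    then have "inj_on p U"
      using \<U>[OF U(1)] homeomorphic_imp_injective_map by metis
    moreover define N where "N = {w \<in> topspace W. g w \<in> U} \<inter> {w \<in> topspace W. g' w \<in> U}"
    ultimately have "N \<subseteq> S"
      using lift by (auto simp: S_def inj_on_def)
    moreover have "openin W N"
      unfolding N_def using \<U>[OF U(1)] g g' by (intro openin_Int openin_continuous_map_preimage) auto
    moreover have "w \<in> N"
      using w U(2) by (simp add: N_def)
    ultimately show "\<exists>T. openin W T \<and> w \<in> T \<and> T \<subseteq> S"
      by blast
  qed
  ultimately have "S = {} \<or> S = topspace W"
    using W connected_space_clopen_in by blast
  moreover have "a \<in> S"
    using a by (simp add: S_def)
  ultimately show ?thesis
    using b by (auto simp: S_def)
qed

section \<open>Odometers from invariant partitions\<close>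

lemma zd_action_in: "zd_action X \<alpha> \<Longrightarrow> x \<in> topspace X \<Longrightarrow> \<alpha> n x \<in> topspace X"
  using homeomorphic_imp_surjective_map by (fastforce simp: zd_action_def)

section \<open>Cosets in the additive group of integer vectors\<close>

lemma r_coset_Zd: "H #>\<^bsub>Zd\<^esub> c = {n. n - c \<in> H}"
  by (auto simp: r_coset_def Zd_def intro: bexI[of _ "_ - c"])

lemma l_coset_Zd: "c <#\<^bsub>Zd\<^esub> H = {n. n - c \<in> H}"
  by (auto simp: l_coset_def Zd_def intro: bexI[of _ "_ - c"])

lemma rcosets_Zd: "rcosets\<^bsub>Zd\<^esub> H = range (\<lambda>c. H #>\<^bsub>Zd\<^esub> c)"
  by (auto simp: RCOSETS_def Zd_def)

lemma group_Zd: "group (Zd :: (int ^ 'd) monoid)"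
proof (rule groupI)
  show "\<exists>y\<in>carrier Zd. y \<otimes>\<^bsub>Zd\<^esub> x = \<one>\<^bsub>Zd\<^esub>" for x :: "int ^ 'd"
    by (intro bexI[of _ "- x"]) (auto simp: Zd_def)
qed (auto simp: Zd_def)

lemma inv_Zd: "inv\<^bsub>Zd\<^esub> n = - n"
  by (rule group.inv_equality[OF group_Zd]) (auto simp: Zd_def)

text \<open>The values of \<open>\<phi> j\<close> serve as labels for the pieces of the
  level-\<open>j\<close> partition. The assumptions \<open>trivial\<close> and \<open>strict\<close>
  correspond to \<open>\<Gamma> 0 = UNIV\<close> and to the strict inclusions in
  \<open>odometer_tower\<close>.\<close>

locale equivariant_partitions =
  fixes X :: "'x topology" and \<alpha> :: "int ^ 'd \<Rightarrow> 'x \<Rightarrow> 'x" and \<phi> :: "nat \<Rightarrow> 'x \<Rightarrow> 'c" and x0 :: 'x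
  assumes compact: "compact_space X"
    and action: "zd_action X \<alpha>"
    and minimal: "minimal_action X \<alpha>"
    and x0: "x0 \<in> topspace X"
    and finite_values: "finite (\<phi> j ` topspace X)"
    and open_pieces: "openin X {x \<in> topspace X. \<phi> j x = c}"
    and equivariant: "x \<in> topspace X \<Longrightarrow> y \<in> topspace X \<Longrightarrow> \<phi> j x = \<phi> j y \<Longrightarrow> \<phi> j (\<alpha> n x) = \<phi> j (\<alpha> n y)"
    and refine: "x \<in> topspace X \<Longrightarrow> y \<in> topspace X \<Longrightarrow> \<phi> (Suc j) x = \<phi> (Suc j) y \<Longrightarrow> \<phi> j x = \<phi> j y"
    and separate: "x \<in> topspace X \<Longrightarrow> y \<in> topspace X \<Longrightarrow> (\<And>j. \<phi> j x = \<phi> j y) \<Longrightarrow> x = y"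
    and trivial: "x \<in> topspace X \<Longrightarrow> y \<in> topspace X \<Longrightarrow> \<phi> 0 x = \<phi> 0 y"
    and strict: "\<exists>x\<in>topspace X. \<phi> j x = \<phi> j x0 \<and> \<phi> (Suc j) x \<noteq> \<phi> (Suc j) x0"
begin

text \<open>For \<open>x = x0\<close> this is the stabiliser of the piece of \<open>x0\<close>; for
  other points of \<open>X\<close> it turns out to be a coset of it, that is, a coordinate in the
  odometer.\<close>

definition visits :: "nat \<Rightarrow> 'x \<Rightarrow> (int ^ 'd) set" where
  "visits j x = {n. \<phi> j (\<alpha> n x0) = \<phi> j x}"

lemma orbit_in [simp]: "x \<in> topspace X \<Longrightarrow> \<alpha> n x \<in> topspace X"
  using action by (rule zd_action_in)

lemma act_add: "x \<in> topspace X \<Longrightarrow> \<alpha> m (\<alpha> n x) = \<alpha> (m + n) x"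
  and act_zero: "x \<in> topspace X \<Longrightarrow> \<alpha> 0 x = x"
  using action by (simp_all add: zd_action_def)

lemma equivariant_iff:
  assumes "x \<in> topspace X" "y \<in> topspace X"
  shows "\<phi> j (\<alpha> n x) = \<phi> j (\<alpha> n y) \<longleftrightarrow> \<phi> j x = \<phi> j y"
proof
  assume "\<phi> j (\<alpha> n x) = \<phi> j (\<alpha> n y)"
  then have "\<phi> j (\<alpha> (- n) (\<alpha> n x)) = \<phi> j (\<alpha> (- n) (\<alpha> n y))"
    by (rule equivariant[rotated 2]) (use assms in auto)
  then show "\<phi> j x = \<phi> j y"
    using assms by (simp add: act_add act_zero)
qed (rule equivariant[OF assms])

text \<open>Minimality enters here: the piece of \<open>x\<close> is open and nonempty, so the dense
  orbit of \<open>x0\<close> meets it.\<close>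

lemma visits_nonempty:
  assumes "x \<in> topspace X"
  obtains n where "n \<in> visits j x"
proof -
  have "x \<in> X closure_of range (\<lambda>n. \<alpha> n x0)"
    using minimal x0 assms by (simp add: minimal_action_def)
  then have "\<And>U. x \<in> U \<Longrightarrow> openin X U \<Longrightarrow> \<exists>y\<in>range (\<lambda>n. \<alpha> n x0). y \<in> U"
    by (simp add: in_closure_of)
  from this[OF _ open_pieces[of j "\<phi> j x"]]
  have "\<exists>y\<in>range (\<lambda>n. \<alpha> n x0). y \<in> {y \<in> topspace X. \<phi> j y = \<phi> j x}"
    using assms by simp
  then show thesis
    using that by (auto simp: visits_def)
qed

lemma visits_eq_iff:
  assumes "x \<in> topspace X" "y \<in> topspace X"
  shows "visits j x = visits j y \<longleftrightarrow> \<phi> j x = \<phi> j y"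
proof
  assume "visits j x = visits j y"
  moreover obtain n where "n \<in> visits j x"
    using visits_nonempty[OF assms(1)] .
  ultimately have "n \<in> visits j x" "n \<in> visits j y"
    by simp_all
  then show "\<phi> j x = \<phi> j y"
    by (simp add: visits_def)
qed (simp add: visits_def)

text \<open>Acting by \<open>n\<close> permutes the pieces and sends the piece of \<open>x0\<close>
  to that of \<open>x\<close>, so a time \<open>m\<close> visits the latter exactly when
  \<open>m - n\<close> stabilises the former.\<close>

lemma visits_eq_r_coset:
  assumes n: "n \<in> visits j x"
  shows "visits j x = visits j x0 #>\<^bsub>Zd\<^esub> n"
proof -
  have "\<phi> j (\<alpha> m x0) = \<phi> j (\<alpha> n x0) \<longleftrightarrow> \<phi> j (\<alpha> (m - n) x0) = \<phi> j x0" for m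
    using equivariant_iff[of "\<alpha> (m - n) x0" x0 j n] x0 by (simp add: act_add)
  then show ?thesis
    using n by (auto simp: visits_def r_coset_Zd)
qed

lemma visits_Suc_subset:
  assumes "x \<in> topspace X"
  shows "visits (Suc j) x \<subseteq> visits j x"
  unfolding visits_def using refine[OF orbit_in[OF x0] assms] by blast

text \<open>This is the bonding condition in \<open>odometer_space\<close>: by refinement all cosets
  in the union coincide, and there is at least one of them.\<close>

lemma visits_compatible:
  assumes "x \<in> topspace X"
  shows "(\<Union>n\<in>visits (Suc j) x. visits j x0 #>\<^bsub>Zd\<^esub> n) = visits j x"
proof -
  have "visits j x0 #>\<^bsub>Zd\<^esub> n = visits j x" if "n \<in> visits (Suc j) x" for n
    using visits_Suc_subset[OF assms] that by (intro visits_eq_r_coset[symmetric]) auto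
  moreover obtain n where "n \<in> visits (Suc j) x"
    using visits_nonempty[OF assms] .
  ultimately show ?thesis
    by auto
qed

text \<open>Acting by \<open>m\<close> delays all visits by \<open>m\<close>, which is the left
  translation by \<open>m\<close> in the odometer.\<close>

lemma visits_act:
  assumes "x \<in> topspace X"
  shows "visits j (\<alpha> m x) = {n. n - m \<in> visits j x}"
proof -
  have "\<phi> j (\<alpha> n x0) = \<phi> j (\<alpha> m x) \<longleftrightarrow> \<phi> j (\<alpha> (n - m) x0) = \<phi> j x" for n
    using equivariant_iff[of "\<alpha> (n - m) x0" x j m] assms x0 by (simp add: act_add)
  then show ?thesis
    by (simp add: visits_def)
qed

lemma subgroup_visits: "subgroup (visits j x0) Zd"
proof (rule group.subgroupI[OF group_Zd])
  show "visits j x0 \<noteq> {}"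
    using visits_nonempty[OF x0] by blast
  fix m n assume mn: "m \<in> visits j x0" "n \<in> visits j x0"
  show "m \<otimes>\<^bsub>Zd\<^esub> n \<in> visits j x0"
    using mn equivariant_iff[of "\<alpha> n x0" x0 j m] x0 by (simp add: visits_def Zd_def act_add)
next
  fix n assume "n \<in> visits j x0"
  then show "inv\<^bsub>Zd\<^esub> n \<in> visits j x0"
    using equivariant_iff[of "\<alpha> n x0" x0 j "- n"] x0
    by (simp add: visits_def inv_Zd act_add act_zero)
qed (simp add: Zd_def)

text \<open>Every coset is realised on the orbit of \<open>x0\<close>: the coset of \<open>n\<close>
  belongs to the point \<open>\<alpha> n x0\<close>.\<close>

lemma rcosets_visits: "rcosets\<^bsub>Zd\<^esub> (visits j x0) = visits j ` topspace X"
proof (intro subset_antisym subsetI)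
  fix C assume "C \<in> rcosets\<^bsub>Zd\<^esub> (visits j x0)"
  then obtain n where "C = visits j x0 #>\<^bsub>Zd\<^esub> n"
    by (auto simp: rcosets_Zd)
  also have "\<dots> = visits j (\<alpha> n x0)"
    by (rule visits_eq_r_coset[symmetric]) (simp add: visits_def)
  finally show "C \<in> visits j ` topspace X"
    using x0 by simp
next
  fix C assume "C \<in> visits j ` topspace X"
  then obtain x where x: "x \<in> topspace X" "C = visits j x" by blast
  obtain n where "n \<in> visits j x"
    using visits_nonempty[OF x(1)] .
  from visits_eq_r_coset[OF this] x(2) show "C \<in> rcosets\<^bsub>Zd\<^esub> (visits j x0)"
    unfolding rcosets_Zd by blast
qed

lemma odometer_tower_visits: "odometer_tower (\<lambda>j. visits j x0)"
  unfolding odometer_tower_def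
proof (intro conjI allI)
  show "visits 0 x0 = UNIV"
    using trivial[OF orbit_in[OF x0] x0] by (simp add: visits_def)
  fix j
  show "subgroup (visits j x0) Zd"
    by (rule subgroup_visits)
  have "visits j ` topspace X \<subseteq> (\<lambda>c. {n. \<phi> j (\<alpha> n x0) = c}) ` \<phi> j ` topspace X"
    by (auto simp: visits_def)
  then show "finite (rcosets\<^bsub>Zd\<^esub> (visits j x0))"
    unfolding rcosets_visits using finite_values by (meson finite_imageI finite_subset)
  obtain x where x: "x \<in> topspace X" "\<phi> j x = \<phi> j x0" "\<phi> (Suc j) x \<noteq> \<phi> (Suc j) x0"
    using strict by blast
  \<comment> \<open>The point \<open>x\<close> shares the piece of \<open>x0\<close> at level
    \<open>j\<close> but not at the next level, so a visiting time for its finer piece lies in the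
    coarser stabiliser and outside the finer one.\<close>
  obtain n where n: "n \<in> visits (Suc j) x"
    using visits_nonempty[OF x(1)] .
  then have "n \<notin> visits (Suc j) x0" "n \<in> visits j x0"
    using x visits_Suc_subset[OF x(1), of j] by (auto simp: visits_def)
  then show "visits (Suc j) x0 \<subset> visits j x0"
    using visits_Suc_subset[OF x0] by blast
qed

lemma topspace_odometer_visits:
  "topspace (odometer_space (\<lambda>j. visits j x0)) =
    {\<omega>. \<forall>j. \<omega> j \<in> visits j ` topspace X \<and> (\<Union>n\<in>\<omega> (Suc j). visits j x0 #>\<^bsub>Zd\<^esub> n) = \<omega> j}"
  by (rule Set.set_eqI) (simp add: odometer_space_def inverse_limit_def rcosets_visits PiE_iff all_conj_distrib)

text \<open>\<open>visits j\<close> is constant on the open pieces, so each preimage is a union of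
  pieces.\<close>

lemma continuous_visits:
  assumes "visits j ` topspace X \<subseteq> S"
  shows "continuous_map X (discrete_topology S) (visits j)"
  unfolding continuous_map_def
proof (intro conjI allI impI)
  show "visits j \<in> topspace X \<rightarrow> topspace (discrete_topology S)"
    using assms by auto
  fix U
  have eq: "visits j x = visits j y" if "x \<in> topspace X" "y \<in> topspace X" "\<phi> j x = \<phi> j y" for x y
    using visits_eq_iff[OF that(1,2)] that(3) by blast
  have "{x \<in> topspace X. visits j x \<in> U} = (\<Union>c\<in>{\<phi> j y |y. y \<in> topspace X \<and> visits j y \<in> U}. {x \<in> topspace X. \<phi> j x = c})"
    by auto (metis eq)
  then show "openin X {x \<in> topspace X. visits j x \<in> U}"
    using open_pieces by auto
qed

text \<open>A continuous bijection from a compact space to a Hausdorff space is a homeomorphism;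
  injectivity is \<open>separate\<close>, and surjectivity uses compactness again.\<close>

lemma homeomorphic_map_visits:
  "homeomorphic_map X (odometer_space (\<lambda>j. visits j x0)) (\<lambda>x j. visits j x)"
proof (rule continuous_imp_homeomorphic_map)
  show "compact_space X" by (rule compact)
  show "Hausdorff_space (odometer_space (\<lambda>j. visits j x0))"
    unfolding odometer_space_def inverse_limit_def
    by (intro Hausdorff_space_subtopology) (simp add: Hausdorff_space_product_topology)
  show "continuous_map X (odometer_space (\<lambda>j. visits j x0)) (\<lambda>x j. visits j x)"
    unfolding odometer_space_def inverse_limit_def
    by (auto simp: continuous_map_in_subtopology continuous_map_componentwise_UNIV rcosets_visits
        visits_compatible intro!: continuous_visits)
  show "inj_on (\<lambda>x j. visits j x) (topspace X)"
  proof (rule inj_onI)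
    fix x y assume xy: "x \<in> topspace X" "y \<in> topspace X" and "(\<lambda>j. visits j x) = (\<lambda>j. visits j y)"
    then have "\<phi> j x = \<phi> j y" for j
      using visits_eq_iff[OF xy, of j] by meson
    then show "x = y"
      using xy by (rule separate[rotated 2])
  qed
  show "(\<lambda>x j. visits j x) ` topspace X = topspace (odometer_space (\<lambda>j. visits j x0))"
  proof (intro subset_antisym subsetI)
    fix \<omega> assume "\<omega> \<in> (\<lambda>x j. visits j x) ` topspace X"
    then obtain x where "x \<in> topspace X" "\<omega> = (\<lambda>j. visits j x)"
      by blast
    then show "\<omega> \<in> topspace (odometer_space (\<lambda>j. visits j x0))"
      by (simp add: topspace_odometer_visits visits_compatible)
  next
    fix \<omega> assume "\<omega> \<in> topspace (odometer_space (\<lambda>j. visits j x0))"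
    then have \<omega>: "\<omega> j \<in> visits j ` topspace X"
        "(\<Union>n\<in>\<omega> (Suc j). visits j x0 #>\<^bsub>Zd\<^esub> n) = \<omega> j" for j
      by (simp_all add: topspace_odometer_visits)
    \<comment> \<open>Each coordinate determines the previous one, so these nonempty closed sets
      decrease; a common point has all its coordinates equal to those of
      \<open>\<omega>\<close>.\<close>
    define K where "K j = {x \<in> topspace X. visits j x \<in> {\<omega> j}}" for j
    have "closedin X (K j)" for j
      unfolding K_def using \<omega>(1) by (intro closedin_continuous_map_preimage[OF continuous_visits[OF order_refl]]) auto
    moreover have "K j \<noteq> {}" for j
      using \<omega>(1)[of j] by (auto simp: K_def)
    moreover have "visits j x = \<omega> j" if "x \<in> topspace X" "visits (Suc j) x = \<omega> (Suc j)" for x j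
      using visits_compatible[OF that(1), of j] \<omega>(2)[of j] that(2) by simp
    then have "decseq K"
      by (auto intro: decseq_SucI simp: K_def)
    ultimately have "(\<Inter>j. K j) \<noteq> {}"
      using compact by (intro compact_space_imp_nest)
    then obtain x where "x \<in> (\<Inter>j. K j)"
      by blast
    then have "x \<in> topspace X" "\<omega> = (\<lambda>j. visits j x)"
      by (simp_all add: K_def)
    then show "\<omega> \<in> (\<lambda>x j. visits j x) ` topspace X"
      by blast
  qed
qed

lemma odometer_action_visits:
  "x \<in> topspace X \<Longrightarrow> (\<lambda>j. visits j (\<alpha> n x)) = odometer_action n (\<lambda>j. visits j x)"
  by (simp add: odometer_action_def visits_act l_coset_Zd)

end

section \<open>Isomorphisms of enveloping C*-algebras\<close>

text \<open>\<open>lim\<close> is a definite description, so it is enough that both sequences have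
  the same limits; this also covers sequences without a limit.\<close>

lemma lim_eq_if_diff_tendsto_0:
  fixes x y :: "nat \<Rightarrow> real"
  assumes "(\<lambda>k. x k - y k) \<longlonglongrightarrow> 0"
  shows "lim x = lim y"
proof -
  have "x \<longlonglongrightarrow> L \<longleftrightarrow> y \<longlonglongrightarrow> L" for L
  proof
    assume "x \<longlonglongrightarrow> L"
    from tendsto_diff[OF this assms] show "y \<longlonglongrightarrow> L" by simp
  next
    assume "y \<longlonglongrightarrow> L"
    from tendsto_add[OF this assms] show "x \<longlonglongrightarrow> L" by simp
  qed
  then show ?thesis
    by (simp add: lim_def)
qed

text \<open>The algebra laws of \<open>A\<close> enter through \<open>diff_add\<close> and
  \<open>minus_diff\<close>, which yield the reverse triangle inequality for the enveloping norm.
  Closure of \<open>B\<close> under its operations follows along the bijection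
  \<open>T\<close>.\<close>

locale star_algebra_iso =
  fixes A :: "('a, 'm) star_algebra_scheme" and B :: "('b, 'n) star_algebra_scheme"
    and T :: "'a \<Rightarrow> 'b" and \<nu> :: "'a \<Rightarrow> real" and \<mu> :: "'b \<Rightarrow> real"
  assumes bij: "bij_betw T (carrier A) (carrier B)"
    and closed: "\<one>\<^bsub>A\<^esub> \<in> carrier A"
      "\<And>a b. a \<in> carrier A \<Longrightarrow> b \<in> carrier A \<Longrightarrow> a \<otimes>\<^bsub>A\<^esub> b \<in> carrier A"
      "\<And>a b. a \<in> carrier A \<Longrightarrow> b \<in> carrier A \<Longrightarrow> a \<oplus>\<^bsub>A\<^esub> b \<in> carrier A"
      "\<And>c a. a \<in> carrier A \<Longrightarrow> c \<odot>\<^bsub>A\<^esub> a \<in> carrier A"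
      "\<And>a. a \<in> carrier A \<Longrightarrow> adj A a \<in> carrier A"
    and hom: "T \<one>\<^bsub>A\<^esub> = \<one>\<^bsub>B\<^esub>"
      "\<And>a b. a \<in> carrier A \<Longrightarrow> b \<in> carrier A \<Longrightarrow> T (a \<otimes>\<^bsub>A\<^esub> b) = T a \<otimes>\<^bsub>B\<^esub> T b"
      "\<And>a b. a \<in> carrier A \<Longrightarrow> b \<in> carrier A \<Longrightarrow> T (a \<oplus>\<^bsub>A\<^esub> b) = T a \<oplus>\<^bsub>B\<^esub> T b"
      "\<And>c a. a \<in> carrier A \<Longrightarrow> T (c \<odot>\<^bsub>A\<^esub> a) = c \<odot>\<^bsub>B\<^esub> T a"
      "\<And>a. a \<in> carrier A \<Longrightarrow> T (adj A a) = adj B (T a)"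
    and isometric: "\<And>a. a \<in> carrier A \<Longrightarrow> \<mu> (T a) = \<nu> a"
    and nonneg: "\<And>a. a \<in> carrier A \<Longrightarrow> 0 \<le> \<nu> a"
    and diff_add: "\<And>a b. a \<in> carrier A \<Longrightarrow> b \<in> carrier A \<Longrightarrow> (a \<oplus>\<^bsub>A\<^esub> (- 1) \<odot>\<^bsub>A\<^esub> b) \<oplus>\<^bsub>A\<^esub> b = a"
    and minus_diff: "\<And>a b. a \<in> carrier A \<Longrightarrow> b \<in> carrier A \<Longrightarrow>
      (- 1) \<odot>\<^bsub>A\<^esub> (a \<oplus>\<^bsub>A\<^esub> (- 1) \<odot>\<^bsub>A\<^esub> b) = b \<oplus>\<^bsub>A\<^esub> (- 1) \<odot>\<^bsub>A\<^esub> a"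
begin

section \<open>Enveloping norms and completions under an isometric star-isomorphism\<close>

abbreviation "N \<equiv> enveloping_norm A \<nu>"
abbreviation "M \<equiv> enveloping_norm B \<mu>"

lemma T_in: "a \<in> carrier A \<Longrightarrow> T a \<in> carrier B"
  using bij by (auto simp: bij_betw_def)

lemma cstar_seminorm_pullback: "cstar_seminorm B p \<Longrightarrow> cstar_seminorm A (p \<circ> T)"
  unfolding cstar_seminorm_def by (simp add: hom T_in closed)

text \<open>Since \<open>carrier B\<close> is the image of \<open>T\<close>, quantifiers over
  \<open>B\<close> turn into quantifiers over \<open>A\<close>, and \<open>hom\<close> read
  backwards turns each operation on images into an image.\<close>

lemma cstar_seminorm_pushforward:
  assumes p: "cstar_seminorm A p"
  shows "cstar_seminorm B (p \<circ> inv_into (carrier A) T)"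
proof -
  let ?q = "p \<circ> inv_into (carrier A) T"
  have q: "?q (T a) = p a" if "a \<in> carrier A" for a
    using bij that by (simp add: bij_betw_inv_into_left)
  have B: "carrier B = T ` carrier A"
    using bij by (simp add: bij_betw_def)
  show ?thesis
    unfolding cstar_seminorm_def B ball_simps
    using p by (simp add: q closed cstar_seminorm_def flip: hom del: comp_apply)
qed

text \<open>Composition with \<open>T\<close> and with its inverse matches the dominated
  C*-seminorms on the two sides, so both suprema are taken over the same set of reals.\<close>

lemma enveloping_norm_iso:
  assumes a: "a \<in> carrier A"
  shows "M (T a) = N a"
proof -
  have "(\<lambda>p. p (T a)) ` {p. cstar_seminorm B p \<and> (\<forall>b\<in>carrier B. p b \<le> \<mu> b)} =
        (\<lambda>p. p a) ` {p. cstar_seminorm A p \<and> (\<forall>b\<in>carrier A. p b \<le> \<nu> b)}" (is "?L = ?R")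
  proof (intro subset_antisym subsetI)
    fix r assume "r \<in> ?L"
    then obtain p where p: "cstar_seminorm B p" "\<forall>b\<in>carrier B. p b \<le> \<mu> b" "r = p (T a)" by blast
    then show "r \<in> ?R"
      using cstar_seminorm_pullback[OF p(1)] T_in isometric
      by (intro image_eqI[of _ _ "p \<circ> T"]) (auto, metis)
  next
    fix r assume "r \<in> ?R"
    then obtain p where p: "cstar_seminorm A p" "\<forall>b\<in>carrier A. p b \<le> \<nu> b" "r = p a" by blast
    have inv: "inv_into (carrier A) T (T b) = b" if "b \<in> carrier A" for b
      using bij that by (simp add: bij_betw_inv_into_left)
    have "carrier B = T ` carrier A"
      using bij by (simp add: bij_betw_def)
    then have "\<forall>b\<in>carrier B. (p \<circ> inv_into (carrier A) T) b \<le> \<mu> b"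
      using p(2) by (simp add: inv isometric)
    then show "r \<in> ?L"
      using cstar_seminorm_pushforward[OF p(1)] p(3) a
      by (intro image_eqI[of _ _ "p \<circ> inv_into (carrier A) T"]) (auto simp: inv)
  qed
  then show ?thesis
    by (simp add: enveloping_norm_def)
qed

lemma enveloping_norm_upper:
  assumes "cstar_seminorm A p" "\<And>b. b \<in> carrier A \<Longrightarrow> p b \<le> \<nu> b" "a \<in> carrier A"
  shows "p a \<le> N a"
  unfolding enveloping_norm_def using assms by (intro cSUP_upper bdd_aboveI[of _ "\<nu> a"]) auto

text \<open>Together with \<open>nonneg\<close> this makes the family of dominated C*-seminorms
  nonempty, so that its real supremum is meaningful.\<close>

lemma cstar_seminorm_zero: "cstar_seminorm A (\<lambda>_. 0)"
  by (simp add: cstar_seminorm_def)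

lemma enveloping_norm_nonneg: "a \<in> carrier A \<Longrightarrow> 0 \<le> N a"
  using enveloping_norm_upper[OF cstar_seminorm_zero] nonneg by blast

text \<open>Each dominated C*-seminorm satisfies the triangle inequality, and the supremum inherits
  it. By \<open>minus_diff\<close> and homogeneity, swapping \<open>a\<close> and \<open>b\<close>
  leaves the norm of the difference unchanged.\<close>

lemma enveloping_norm_triangle:
  assumes a: "a \<in> carrier A" and b: "b \<in> carrier A"
  shows "\<bar>N a - N b\<bar> \<le> N (a \<oplus>\<^bsub>A\<^esub> (- 1) \<odot>\<^bsub>A\<^esub> b)"
proof -
  have triangle: "N a \<le> N (a \<oplus>\<^bsub>A\<^esub> (- 1) \<odot>\<^bsub>A\<^esub> b) + N b" if ab: "a \<in> carrier A" "b \<in> carrier A" for a b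
    unfolding enveloping_norm_def[of A \<nu> a]
  proof (rule cSUP_least)
    show "{p. cstar_seminorm A p \<and> (\<forall>b\<in>carrier A. p b \<le> \<nu> b)} \<noteq> {}"
      using cstar_seminorm_zero nonneg by blast
    fix p assume p: "p \<in> {p. cstar_seminorm A p \<and> (\<forall>b\<in>carrier A. p b \<le> \<nu> b)}"
    have "p a = p ((a \<oplus>\<^bsub>A\<^esub> (- 1) \<odot>\<^bsub>A\<^esub> b) \<oplus>\<^bsub>A\<^esub> b)"
      using ab by (simp add: diff_add)
    also have "\<dots> \<le> p (a \<oplus>\<^bsub>A\<^esub> (- 1) \<odot>\<^bsub>A\<^esub> b) + p b"
      using p ab closed by (auto simp: cstar_seminorm_def)
    also have "\<dots> \<le> N (a \<oplus>\<^bsub>A\<^esub> (- 1) \<odot>\<^bsub>A\<^esub> b) + N b"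
      using p ab closed by (intro add_mono enveloping_norm_upper) auto
    finally show "p a \<le> \<dots>" .
  qed
  have "p (b \<oplus>\<^bsub>A\<^esub> (- 1) \<odot>\<^bsub>A\<^esub> a) = p (a \<oplus>\<^bsub>A\<^esub> (- 1) \<odot>\<^bsub>A\<^esub> b)" if "cstar_seminorm A p" for p
  proof -
    have "p ((- 1) \<odot>\<^bsub>A\<^esub> (a \<oplus>\<^bsub>A\<^esub> (- 1) \<odot>\<^bsub>A\<^esub> b)) = cmod (- 1) * p (a \<oplus>\<^bsub>A\<^esub> (- 1) \<odot>\<^bsub>A\<^esub> b)"
      using that a b closed unfolding cstar_seminorm_def by blast
    then show ?thesis
      using a b by (simp add: minus_diff)
  qed
  then have "N (b \<oplus>\<^bsub>A\<^esub> (- 1) \<odot>\<^bsub>A\<^esub> a) = N (a \<oplus>\<^bsub>A\<^esub> (- 1) \<odot>\<^bsub>A\<^esub> b)"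
    unfolding enveloping_norm_def by (intro SUP_cong) auto
  then show ?thesis
    using triangle[OF a b] triangle[OF b a] by linarith
qed

text \<open>Acting on all members of a class at once avoids choosing representatives.\<close>

definition lift :: "(nat \<Rightarrow> 'a) set \<Rightarrow> (nat \<Rightarrow> 'b) set" where
  "lift S = (\<lambda>a. T \<circ> a) ` S"

lemma cauchy_sequences_comp:
  assumes "range a \<subseteq> carrier A"
  shows "T \<circ> a \<in> cauchy_sequences B M \<longleftrightarrow> a \<in> cauchy_sequences A N"
proof -
  have a: "a k \<in> carrier A" for k
    using assms by blast
  have "M (T (a k) \<oplus>\<^bsub>B\<^esub> (- 1) \<odot>\<^bsub>B\<^esub> T (a l)) = N (a k \<oplus>\<^bsub>A\<^esub> (- 1) \<odot>\<^bsub>A\<^esub> a l)" for k l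
    using a by (simp add: closed enveloping_norm_iso flip: hom)
  then show ?thesis
    using assms T_in by (auto simp: cauchy_sequences_def)
qed

lemma cauchy_sequences_surj: "cauchy_sequences B M = (\<lambda>a. T \<circ> a) ` cauchy_sequences A N"
proof (intro subset_antisym subsetI)
  fix b assume b: "b \<in> cauchy_sequences B M"
  define a where "a = inv_into (carrier A) T \<circ> b"
  have b': "b k \<in> T ` carrier A" for k
    using b bij by (auto simp: cauchy_sequences_def bij_betw_def)
  have "range a \<subseteq> carrier A" "T \<circ> a = b"
    using b' by (auto simp: a_def inv_into_into f_inv_into_f fun_eq_iff)
  then show "b \<in> (\<lambda>a. T \<circ> a) ` cauchy_sequences A N"
    using b cauchy_sequences_comp[of a] by blast
next
  fix b assume "b \<in> (\<lambda>a. T \<circ> a) ` cauchy_sequences A N"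
  then show "b \<in> cauchy_sequences B M"
    using cauchy_sequences_comp by (auto simp: cauchy_sequences_def[of A])
qed

lemma cauchy_in: "a \<in> cauchy_sequences A N \<Longrightarrow> a k \<in> carrier A"
  by (auto simp: cauchy_sequences_def)

lemma null_difference_comp:
  assumes "a \<in> cauchy_sequences A N" "b \<in> cauchy_sequences A N"
  shows "(T \<circ> a, T \<circ> b) \<in> null_difference B M \<longleftrightarrow> (a, b) \<in> null_difference A N"
proof -
  have "M (T (a k) \<oplus>\<^bsub>B\<^esub> (- 1) \<odot>\<^bsub>B\<^esub> T (b k)) = N (a k \<oplus>\<^bsub>A\<^esub> (- 1) \<odot>\<^bsub>A\<^esub> b k)" for k
    using cauchy_in assms by (simp add: closed enveloping_norm_iso flip: hom)
  then show ?thesis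
    using assms cauchy_sequences_surj by (auto simp: null_difference_def)
qed

text \<open>Both classes are empty when \<open>a\<close> is not Cauchy. Covering that case lets
  termwise products and adjoints be transported without first showing that they are Cauchy.\<close>

lemma lift_class:
  assumes a: "range a \<subseteq> carrier A"
  shows "lift (null_difference A N `` {a}) = null_difference B M `` {T \<circ> a}"
proof (cases "a \<in> cauchy_sequences A N")
  case True
  show ?thesis
  proof (intro subset_antisym subsetI)
    fix b assume "b \<in> lift (null_difference A N `` {a})"
    then obtain c where c: "(a, c) \<in> null_difference A N" "b = T \<circ> c"
      by (auto simp: lift_def)
    then have "c \<in> cauchy_sequences A N"
      by (auto simp: null_difference_def)
    then show "b \<in> null_difference B M `` {T \<circ> a}"
      using c True null_difference_comp by simp
  next
    fix b assume b: "b \<in> null_difference B M `` {T \<circ> a}"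
    then have "b \<in> cauchy_sequences B M"
      by (auto simp: null_difference_def)
    then obtain c where "c \<in> cauchy_sequences A N" "b = T \<circ> c"
      by (auto simp: cauchy_sequences_surj)
    then show "b \<in> lift (null_difference A N `` {a})"
      using b True null_difference_comp by (auto simp: lift_def)
  qed
next
  case False
  then have "T \<circ> a \<notin> cauchy_sequences B M"
    using cauchy_sequences_comp[OF a] by simp
  then show ?thesis
    using False by (auto simp: null_difference_def lift_def)
qed

lemma completion_carrier_in:
  "S \<in> carrier (completion A N) \<Longrightarrow> a \<in> S \<Longrightarrow> a k \<in> carrier A"
  by (auto simp: completion_def Let_def quotient_def null_difference_def intro: cauchy_in)

lemma lift_UN: "lift (\<Union>a\<in>S. F a) = (\<Union>a\<in>S. lift (F a))"
  by (auto simp: lift_def)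

text \<open>Injectivity holds because composing with \<open>T\<close> is injective on sequences in
  the carrier, hence on sets of them; surjectivity comes from
  \<open>cauchy_sequences_surj\<close>.\<close>

lemma bij_betw_lift: "bij_betw lift (carrier (completion A N)) (carrier (completion B M))"
proof (rule bij_betwI')
  fix R S assume RS: "R \<in> carrier (completion A N)" "S \<in> carrier (completion A N)"
  have "inj_on (\<lambda>a. T \<circ> a) {a. range a \<subseteq> carrier A}"
    using bij by (auto simp: inj_on_def bij_betw_def fun_eq_iff image_subset_iff)
  moreover have "R \<subseteq> {a. range a \<subseteq> carrier A}" "S \<subseteq> {a. range a \<subseteq> carrier A}"
    using completion_carrier_in RS by blast+
  ultimately show "lift R = lift S \<longleftrightarrow> R = S"
    unfolding lift_def by (rule inj_on_image_eq_iff)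
next
  fix R assume "R \<in> carrier (completion A N)"
  then obtain a where a: "a \<in> cauchy_sequences A N" "R = null_difference A N `` {a}"
    by (auto simp: completion_def Let_def elim: quotientE)
  then have "lift R = null_difference B M `` {T \<circ> a}"
    using cauchy_in by (auto intro!: lift_class)
  then show "lift R \<in> carrier (completion B M)"
    using a cauchy_sequences_surj by (auto simp: completion_def Let_def intro: quotientI)
next
  fix S assume "S \<in> carrier (completion B M)"
  then obtain a where a: "a \<in> cauchy_sequences A N" "S = null_difference B M `` {T \<circ> a}"
    by (auto simp: completion_def Let_def cauchy_sequences_surj elim!: quotientE)
  then have "S = lift (null_difference A N `` {a})"
    using cauchy_in by (auto intro!: lift_class[symmetric])
  moreover have "null_difference A N `` {a} \<in> carrier (completion A N)"
    using a(1) by (auto simp: completion_def Let_def intro: quotientI)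
  ultimately show "\<exists>R\<in>carrier (completion A N). S = lift R"
    by blast
qed

text \<open>Setting \<open>l = k\<close> in the Cauchy condition gives the limit directly.
  Reflexivity makes the classes in the completion nonempty.\<close>

lemma null_difference_refl:
  assumes "a \<in> cauchy_sequences A N"
  shows "(a, a) \<in> null_difference A N"
proof -
  have "0 \<le> N (a k \<oplus>\<^bsub>A\<^esub> (- 1) \<odot>\<^bsub>A\<^esub> a k)" for k
    using cauchy_in[OF assms] by (intro enveloping_norm_nonneg closed)
  moreover have "\<exists>K. \<forall>k\<ge>K. N (a k \<oplus>\<^bsub>A\<^esub> (- 1) \<odot>\<^bsub>A\<^esub> a k) < e" if "e > 0" for e
  proof -
    have "\<forall>e>0. \<exists>K. \<forall>k\<ge>K. \<forall>l\<ge>K. N (a k \<oplus>\<^bsub>A\<^esub> (- 1) \<odot>\<^bsub>A\<^esub> a l) < e"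
      using assms by (simp add: cauchy_sequences_def)
    then obtain K where K: "\<forall>k\<ge>K. \<forall>l\<ge>K. N (a k \<oplus>\<^bsub>A\<^esub> (- 1) \<odot>\<^bsub>A\<^esub> a l) < e"
      using \<open>e > 0\<close> by meson
    show ?thesis
    proof (intro exI allI impI)
      fix k assume "K \<le> k"
      then show "N (a k \<oplus>\<^bsub>A\<^esub> (- 1) \<odot>\<^bsub>A\<^esub> a k) < e"
        by (simp add: K)
    qed
  qed
  ultimately have "(\<lambda>k. N (a k \<oplus>\<^bsub>A\<^esub> (- 1) \<odot>\<^bsub>A\<^esub> a k)) \<longlonglongrightarrow> 0"
    by (simp add: LIMSEQ_iff)
  then show ?thesis
    using assms by (simp add: null_difference_def)
qed

text \<open>\<open>cnorm\<close> evaluates a member picked by \<open>SOME\<close>; the reverse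
  triangle inequality shows that every member gives the same value, each being compared with the
  generator \<open>c\<close> of the class.\<close>

lemma cnorm_completion:
  assumes S: "S \<in> carrier (completion A N)" and a: "a \<in> S"
  shows "cnorm (completion A N) S = lim (\<lambda>k. N (a k))"
proof -
  obtain c where c: "S = null_difference A N `` {c}"
    using S by (auto simp: completion_def Let_def elim: quotientE)
  have lim_c: "lim (\<lambda>k. N (c k)) = lim (\<lambda>k. N (b k))" if "b \<in> S" for b
  proof (rule lim_eq_if_diff_tendsto_0, rule Lim_null_comparison)
    have cb: "(c, b) \<in> null_difference A N"
      using that c by simp
    then show "(\<lambda>k. N (c k \<oplus>\<^bsub>A\<^esub> (- 1) \<odot>\<^bsub>A\<^esub> b k)) \<longlonglongrightarrow> 0"
      by (auto simp: null_difference_def)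
    have "c k \<in> carrier A" "b k \<in> carrier A" for k
      using cb by (auto simp: null_difference_def intro: cauchy_in)
    then show "\<forall>\<^sub>F k in sequentially. norm (N (c k) - N (b k)) \<le> N (c k \<oplus>\<^bsub>A\<^esub> (- 1) \<odot>\<^bsub>A\<^esub> b k)"
      by (auto intro: always_eventually enveloping_norm_triangle)
  qed
  have "(SOME a. a \<in> S) \<in> S"
    using a by (auto simp: some_in_eq)
  then show ?thesis
    using lim_c[OF a] lim_c[of "SOME a. a \<in> S"] by (simp add: completion_def Let_def)
qed

text \<open>Operations on classes are unions, over representatives, of the classes of termwise
  results; \<open>lift\<close> commutes with unions, and \<open>hom\<close> moves \<open>T\<close>
  through each term.\<close>

lemma cstar_isomorphic_enveloping:
  "cstar_isomorphic (enveloping_cstar_algebra A \<nu>) (enveloping_cstar_algebra B \<mu>)"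
  unfolding cstar_isomorphic_def enveloping_cstar_algebra_def
proof (intro bexI[of _ lift] conjI ballI allI ring_iso_memI)
  let ?A = "completion A N" and ?B = "completion B M"
  show "bij_betw lift (carrier ?A) (carrier ?B)"
    by (rule bij_betw_lift)
  then show "S \<in> carrier ?A \<Longrightarrow> lift S \<in> carrier ?B" for S
    by (auto simp: bij_betw_def)
  show "lift \<one>\<^bsub>?A\<^esub> = \<one>\<^bsub>?B\<^esub>"
    using closed(1) by (simp add: completion_def Let_def lift_class hom comp_def image_subset_iff)
  fix R S assume R: "R \<in> carrier ?A"
  note R_in = completion_carrier_in[OF R]
  show "lift (c \<odot>\<^bsub>?A\<^esub> R) = c \<odot>\<^bsub>?B\<^esub> lift R" for c
  proof -
    have "lift (c \<odot>\<^bsub>?A\<^esub> R) = (\<Union>a\<in>R. null_difference B M `` {T \<circ> (\<lambda>k. c \<odot>\<^bsub>A\<^esub> a k)})"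
      using R_in by (auto simp: completion_def Let_def lift_UN closed intro!: SUP_cong lift_class)
    also have "\<dots> = c \<odot>\<^bsub>?B\<^esub> lift R"
      using R_in by (auto simp: completion_def Let_def lift_def comp_def hom intro!: SUP_cong)
    finally show ?thesis .
  qed
  show "lift (adj ?A R) = adj ?B (lift R)"
  proof -
    have "lift (adj ?A R) = (\<Union>a\<in>R. null_difference B M `` {T \<circ> (\<lambda>k. adj A (a k))})"
      using R_in by (auto simp: completion_def Let_def lift_UN closed intro!: SUP_cong lift_class)
    also have "\<dots> = adj ?B (lift R)"
      using R_in by (auto simp: completion_def Let_def lift_def comp_def hom intro!: SUP_cong)
    finally show ?thesis .
  qed
  show "cnorm ?B (lift R) = cnorm ?A R"
  proof -
    \<comment> \<open>The member of \<open>lift R\<close> that \<open>SOME\<close> picks is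
      \<open>T \<circ> a\<close> with \<open>a\<close> in \<open>R\<close>, but \<open>a\<close> may
      differ from the member picked in \<open>R\<close>; \<open>cnorm_completion\<close> bridges the
      gap.\<close>
    have "R \<noteq> {}"
      using R null_difference_refl by (auto simp: completion_def Let_def elim!: quotientE)
    then have "(SOME b. b \<in> lift R) \<in> lift R"
      by (simp add: some_in_eq lift_def)
    then obtain a where a: "a \<in> R" "(SOME b. b \<in> lift R) = T \<circ> a"
      by (auto simp: lift_def)
    then have "cnorm ?B (lift R) = lim (\<lambda>k. N (a k))"
      using R_in by (simp add: completion_def Let_def enveloping_norm_iso)
    then show ?thesis
      using cnorm_completion[OF R a(1)] by simp
  qed
  assume S: "S \<in> carrier ?A"
  note S_in = completion_carrier_in[OF S]
  show "lift (R \<otimes>\<^bsub>?A\<^esub> S) = lift R \<otimes>\<^bsub>?B\<^esub> lift S"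
  proof -
    have "lift (R \<otimes>\<^bsub>?A\<^esub> S) = (\<Union>a\<in>R. \<Union>b\<in>S. null_difference B M `` {T \<circ> (\<lambda>k. a k \<otimes>\<^bsub>A\<^esub> b k)})"
      using R_in S_in by (auto simp: completion_def Let_def lift_UN closed intro!: SUP_cong lift_class)
    also have "\<dots> = lift R \<otimes>\<^bsub>?B\<^esub> lift S"
      using R_in S_in by (auto simp: completion_def Let_def lift_def comp_def hom intro!: SUP_cong)
    finally show ?thesis .
  qed
  show "lift (R \<oplus>\<^bsub>?A\<^esub> S) = lift R \<oplus>\<^bsub>?B\<^esub> lift S"
  proof -
    have "lift (R \<oplus>\<^bsub>?A\<^esub> S) = (\<Union>a\<in>R. \<Union>b\<in>S. null_difference B M `` {T \<circ> (\<lambda>k. a k \<oplus>\<^bsub>A\<^esub> b k)})"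
      using R_in S_in by (auto simp: completion_def Let_def lift_UN closed intro!: SUP_cong lift_class)
    also have "\<dots> = lift R \<oplus>\<^bsub>?B\<^esub> lift S"
      using R_in S_in by (auto simp: completion_def Let_def lift_def comp_def hom intro!: SUP_cong)
    finally show ?thesis .
  qed
qed

end

section \<open>Conjugate actions\<close>

lemma cfun_comp:
  assumes "continuous_map Y X \<psi>" "f \<in> cfun X"
  shows "(\<lambda>y. if y \<in> topspace Y then f (\<psi> y) else 0) \<in> cfun Y"
proof -
  have "continuous_map Y euclidean (f \<circ> \<psi>)"
    using assms by (auto simp: cfun_def intro: continuous_map_compose)
  then have "continuous_map Y euclidean (\<lambda>y. if y \<in> topspace Y then f (\<psi> y) else 0)"
    by (rule continuous_map_eq) simp
  then show ?thesis
    by (simp add: cfun_def)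
qed

lemma cfun_action_cfun: "zd_action X \<alpha> \<Longrightarrow> f \<in> cfun X \<Longrightarrow> cfun_action X \<alpha> n f \<in> cfun X"
  unfolding cfun_action_def
  by (intro cfun_comp) (auto simp: zd_action_def homeomorphic_imp_continuous_map)

lemma cfun_add: "f \<in> cfun X \<Longrightarrow> g \<in> cfun X \<Longrightarrow> (\<lambda>x. f x + g x) \<in> cfun X"
  and cfun_mult: "f \<in> cfun X \<Longrightarrow> g \<in> cfun X \<Longrightarrow> (\<lambda>x. f x * g x) \<in> cfun X"
  and cfun_cmult: "f \<in> cfun X \<Longrightarrow> (\<lambda>x. c * f x) \<in> cfun X"
  and cfun_cnj: "f \<in> cfun X \<Longrightarrow> (\<lambda>x. cnj (f x)) \<in> cfun X"
  and cfun_0: "(\<lambda>x. 0) \<in> cfun X"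
  by (auto simp: cfun_def continuous_map_atin intro: tendsto_intros)

lemma cfun_sum: "(\<And>i. i \<in> I \<Longrightarrow> f i \<in> cfun X) \<Longrightarrow> (\<lambda>x. \<Sum>i\<in>I. f i x) \<in> cfun X"
  by (induction I rule: infinite_finite_induct) (auto simp: cfun_0 intro: cfun_add)

lemma twisted_convolution_algebra_one_closed:
  "\<one>\<^bsub>twisted_convolution_algebra X \<alpha> \<sigma>\<^esub> \<in> carrier (twisted_convolution_algebra X \<alpha> \<sigma>)"
proof -
  have "(\<lambda>x. if n = 0 \<and> x \<in> topspace X then 1 else 0) \<in> cfun X" for n :: "int ^ 'd"
  proof (cases "n = 0")
    case True
    have "continuous_map X euclidean (\<lambda>x. if n = 0 \<and> x \<in> topspace X then 1 else (0 :: complex))"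
      by (rule continuous_map_eq[of _ _ "\<lambda>_. 1"]) (simp_all add: True)
    then show ?thesis
      by (simp add: cfun_def)
  qed (simp add: cfun_0)
  moreover have "{n. (\<lambda>x. if n = 0 \<and> x \<in> topspace X then 1 else (0 :: complex)) \<noteq> (\<lambda>_. 0)} \<subseteq> {0}"
    by auto
  ultimately show ?thesis
    using finite_subset by (auto simp: twisted_convolution_algebra_def)
qed

lemma twisted_convolution_algebra_mult_closed:
  assumes "zd_action X \<alpha>"
    and a: "a \<in> carrier (twisted_convolution_algebra X \<alpha> \<sigma>)"
    and b: "b \<in> carrier (twisted_convolution_algebra X \<alpha> \<sigma>)"
  shows "a \<otimes>\<^bsub>twisted_convolution_algebra X \<alpha> \<sigma>\<^esub> b \<in> carrier (twisted_convolution_algebra X \<alpha> \<sigma>)"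
proof -
  let ?c = "\<lambda>n x. \<Sum>m | a m \<noteq> (\<lambda>_. 0). \<sigma> m (n - m) * a m x * cfun_action X \<alpha> m (b (n - m)) x"
  have fin: "finite {n. a n \<noteq> (\<lambda>_. 0)}" "finite {n. b n \<noteq> (\<lambda>_. 0)}"
    and ab: "\<And>n. a n \<in> cfun X" "\<And>n. b n \<in> cfun X"
    using a b by (auto simp: twisted_convolution_algebra_def)
  have "?c n \<in> cfun X" for n
    using ab assms(1) by (intro cfun_sum cfun_mult cfun_cmult cfun_action_cfun)
  \<comment> \<open>A nonzero summand at \<open>n\<close> writes \<open>n\<close> as
    \<open>m + (n - m)\<close> with both parts in the supports, so the support of the product lies
    in a finite sumset.\<close>
  moreover have "{n. ?c n \<noteq> (\<lambda>_. 0)} \<subseteq> (\<lambda>(m, n). m + n) ` ({n. a n \<noteq> (\<lambda>_. 0)} \<times> {n. b n \<noteq> (\<lambda>_. 0)})"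
  proof
    fix n assume n: "n \<in> {n. ?c n \<noteq> (\<lambda>_. 0)}"
    then obtain x where "?c n x \<noteq> 0"
      by (auto simp: fun_eq_iff)
    then obtain m where "a m \<noteq> (\<lambda>_. 0)"
        "\<sigma> m (n - m) * a m x * cfun_action X \<alpha> m (b (n - m)) x \<noteq> 0"
      by (elim sum.not_neutral_contains_not_neutral) simp
    then have "a m \<noteq> (\<lambda>_. 0)" "b (n - m) \<noteq> (\<lambda>_. 0)"
      by (auto simp: cfun_action_def split: if_splits)
    then show "n \<in> (\<lambda>(m, n). m + n) ` ({n. a n \<noteq> (\<lambda>_. 0)} \<times> {n. b n \<noteq> (\<lambda>_. 0)})"
      by (intro image_eqI[of _ _ "(m, n - m)"]) auto
  qed
  then have "finite {n. ?c n \<noteq> (\<lambda>_. 0)}"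
    using fin by (meson finite_SigmaI finite_imageI finite_subset)
  ultimately show ?thesis
    by (simp add: twisted_convolution_algebra_def)
qed

lemma twisted_convolution_algebra_adj_closed:
  assumes "zd_action X \<alpha>" and a: "a \<in> carrier (twisted_convolution_algebra X \<alpha> \<sigma>)"
  shows "adj (twisted_convolution_algebra X \<alpha> \<sigma>) a \<in> carrier (twisted_convolution_algebra X \<alpha> \<sigma>)"
proof -
  let ?c = "\<lambda>n x. cnj (\<sigma> (- n) n) * cfun_action X \<alpha> n (\<lambda>y. cnj (a (- n) y)) x"
  have fin: "finite {n. a n \<noteq> (\<lambda>_. 0)}" and a': "\<And>n. a n \<in> cfun X"
    using a by (auto simp: twisted_convolution_algebra_def)
  have "?c n \<in> cfun X" for n
    using a' assms(1) by (intro cfun_cmult cfun_action_cfun cfun_cnj)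
  moreover have "{n. ?c n \<noteq> (\<lambda>_. 0)} \<subseteq> uminus ` {n. a n \<noteq> (\<lambda>_. 0)}"
  proof
    fix n assume "n \<in> {n. ?c n \<noteq> (\<lambda>_. 0)}"
    then have "a (- n) \<noteq> (\<lambda>_. 0)"
      by (auto simp: cfun_action_def)
    then show "n \<in> uminus ` {n. a n \<noteq> (\<lambda>_. 0)}"
      by (intro image_eqI[of _ _ "- n"]) auto
  qed
  then have "finite {n. ?c n \<noteq> (\<lambda>_. 0)}"
    using fin by (meson finite_imageI finite_subset)
  ultimately show ?thesis
    by (simp add: twisted_convolution_algebra_def)
qed

lemma twisted_convolution_algebra_add_closed:
  assumes "a \<in> carrier (twisted_convolution_algebra X \<alpha> \<sigma>)"
    and "b \<in> carrier (twisted_convolution_algebra X \<alpha> \<sigma>)"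
  shows "a \<oplus>\<^bsub>twisted_convolution_algebra X \<alpha> \<sigma>\<^esub> b \<in> carrier (twisted_convolution_algebra X \<alpha> \<sigma>)"
proof -
  have "{n. (\<lambda>x. a n x + b n x) \<noteq> (\<lambda>_. 0)} \<subseteq> {n. a n \<noteq> (\<lambda>_. 0)} \<union> {n. b n \<noteq> (\<lambda>_. 0)}"
    by auto
  then show ?thesis
    using assms finite_subset
    by (fastforce simp: twisted_convolution_algebra_def intro: cfun_add)
qed

lemma twisted_convolution_algebra_smult_closed:
  assumes "a \<in> carrier (twisted_convolution_algebra X \<alpha> \<sigma>)"
  shows "c \<odot>\<^bsub>twisted_convolution_algebra X \<alpha> \<sigma>\<^esub> a \<in> carrier (twisted_convolution_algebra X \<alpha> \<sigma>)"
proof -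
  have "{n. (\<lambda>x. c * a n x) \<noteq> (\<lambda>_. 0)} \<subseteq> {n. a n \<noteq> (\<lambda>_. 0)}"
    by auto
  then show ?thesis
    using assms finite_subset
    by (fastforce simp: twisted_convolution_algebra_def intro: cfun_cmult)
qed

text \<open>Each coefficient is bounded by compactness, so its real supremum dominates the modulus
  at any point; a nonzero coefficient supplies such a point in the carrier.\<close>

lemma l1_norm_nonneg:
  assumes X: "compact_space X" and a: "\<And>n. a n \<in> cfun X"
  shows "0 \<le> l1_norm X a"
  unfolding l1_norm_def
proof (rule sum_nonneg)
  fix n assume "n \<in> {n. a n \<noteq> (\<lambda>_. 0)}"
  then obtain x where "a n x \<noteq> 0"
    by (auto simp: fun_eq_iff)
  then have x: "x \<in> topspace X"
    using a[of n] by (auto simp: cfun_def)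
  have "compactin euclidean (a n ` topspace X)"
    using X a[of n] image_compactin[of X "topspace X" euclidean "a n"] by (simp add: cfun_def compact_space_def)
  then have "bounded (a n ` topspace X)"
    by (simp add: compact_imp_bounded)
  then have "bdd_above ((\<lambda>x. cmod (a n x)) ` topspace X)"
    by (auto simp: bounded_iff intro: bdd_aboveI)
  then have "cmod (a n x) \<le> (SUP x\<in>topspace X. cmod (a n x))"
    using x by (intro cSUP_upper)
  then show "0 \<le> (SUP x\<in>topspace X. cmod (a n x))"
    using norm_ge_zero order_trans by blast
qed

text \<open>The isomorphism composes every coefficient with the inverse of \<open>\<Phi>\<close> and
  leaves the group elements alone, so the factors \<open>\<sigma> m n\<close> are carried along
  unchanged.\<close>

lemma cstar_isomorphic_conjugate_actions:
  fixes X :: "'x topology" and Y :: "'y topology" and \<alpha> :: "int ^ 'd \<Rightarrow> 'x \<Rightarrow> 'x" and \<Phi> :: "'x \<Rightarrow> 'y"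
  assumes X: "compact_space X" and \<alpha>: "zd_action X \<alpha>" and \<Phi>: "homeomorphic_map X Y \<Phi>"
    and conj: "\<And>n x. x \<in> topspace X \<Longrightarrow> \<Phi> (\<alpha> n x) = \<beta> n (\<Phi> x)"
  shows "cstar_isomorphic (twisted_crossed_product X \<alpha> \<sigma>) (twisted_crossed_product Y \<beta> \<sigma>)"
proof -
  obtain \<Psi> where "homeomorphic_maps X Y \<Phi> \<Psi>"
    using \<Phi> by (auto simp: homeomorphic_map_maps)
  then have cont: "continuous_map X Y \<Phi>" "continuous_map Y X \<Psi>"
    and inv: "\<And>x. x \<in> topspace X \<Longrightarrow> \<Psi> (\<Phi> x) = x" "\<And>y. y \<in> topspace Y \<Longrightarrow> \<Phi> (\<Psi> y) = y"
    by (auto simp: homeomorphic_maps_def)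
  have in_XY: "\<And>x. x \<in> topspace X \<Longrightarrow> \<Phi> x \<in> topspace Y" "\<And>y. y \<in> topspace Y \<Longrightarrow> \<Psi> y \<in> topspace X"
    using cont by (auto simp: continuous_map_def)
  have Y: "topspace Y = \<Phi> ` topspace X"
    using \<Phi> homeomorphic_imp_surjective_map by blast
  \<comment> \<open>The properties of \<open>\<beta>\<close> are inherited from
    \<open>\<alpha>\<close>, since every point of \<open>Y\<close> is some
    \<open>\<Phi> x\<close>.\<close>
  have \<beta>: "\<beta> n y \<in> topspace Y" "\<Psi> (\<beta> n y) = \<alpha> n (\<Psi> y)" if y: "y \<in> topspace Y" for n y
  proof -
    obtain x where x: "y = \<Phi> x" "x \<in> topspace X"
      using y unfolding Y by (rule imageE)
    then have "\<beta> n y = \<Phi> (\<alpha> n x)"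
      by (simp add: conj)
    then show "\<beta> n y \<in> topspace Y" "\<Psi> (\<beta> n y) = \<alpha> n (\<Psi> y)"
      using x Y inv(1) zd_action_in[OF \<alpha> x(2), of n] by simp_all
  qed
  define T where "T a n y = (if y \<in> topspace Y then a n (\<Psi> y) else 0)" for a :: "int ^ 'd \<Rightarrow> 'x \<Rightarrow> complex" and n y
  define S where "S b n x = (if x \<in> topspace X then b n (\<Phi> x) else 0)" for b :: "int ^ 'd \<Rightarrow> 'y \<Rightarrow> complex" and n x
  let ?A = "twisted_convolution_algebra X \<alpha> \<sigma>" and ?B = "twisted_convolution_algebra Y \<beta> \<sigma>"
  have A: "a n \<in> cfun X" "finite {n. a n \<noteq> (\<lambda>_. 0)}" if "a \<in> carrier ?A" for a n
    using that by (auto simp: twisted_convolution_algebra_def)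
  have B: "b n \<in> cfun Y" "finite {n. b n \<noteq> (\<lambda>_. 0)}" if "b \<in> carrier ?B" for b n
    using that by (auto simp: twisted_convolution_algebra_def)
  have ST: "S (T a) = a" if "a \<in> carrier ?A" for a
    using A[OF that] by (auto simp: S_def T_def fun_eq_iff in_XY inv cfun_def)
  have TS: "T (S b) = b" if "b \<in> carrier ?B" for b
    using B[OF that] by (auto simp: S_def T_def fun_eq_iff in_XY inv cfun_def)
  \<comment> \<open>Products and \<open>l1_norm\<close> sum over supports, so the index sets on the
    two sides must be equal.\<close>
  have supp: "T a n = (\<lambda>_. 0) \<longleftrightarrow> a n = (\<lambda>_. 0)" if "a \<in> carrier ?A" for a n
  proof
    assume "T a n = (\<lambda>_. 0)"
    then have "S (T a) n = (\<lambda>_. 0)"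
      by (simp add: S_def fun_eq_iff)
    then show "a n = (\<lambda>_. 0)"
      by (simp add: ST that)
  qed (simp add: T_def fun_eq_iff)
  have T_in: "T a \<in> carrier ?B" if a: "a \<in> carrier ?A" for a
  proof -
    have "T a n = (\<lambda>y. if y \<in> topspace Y then a n (\<Psi> y) else 0)" for n
      by (simp add: T_def fun_eq_iff)
    then have "T a n \<in> cfun Y" for n
      using cfun_comp[OF cont(2) A(1)[OF a]] by simp
    then show ?thesis
      using A(2)[OF a] by (simp add: twisted_convolution_algebra_def supp[OF a])
  qed
  have S_in: "S b \<in> carrier ?A" if b: "b \<in> carrier ?B" for b
  proof -
    have "{n. S b n \<noteq> (\<lambda>_. 0)} \<subseteq> {n. b n \<noteq> (\<lambda>_. 0)}"
      by (auto simp: S_def)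
    then have "finite {n. S b n \<noteq> (\<lambda>_. 0)}"
      using B(2)[OF b] by (rule finite_subset)
    moreover have "S b n = (\<lambda>x. if x \<in> topspace X then b n (\<Phi> x) else 0)" for n
      by (simp add: S_def fun_eq_iff)
    then have "S b n \<in> cfun X" for n
      using cfun_comp[OF cont(1) B(1)[OF b]] by simp
    ultimately show ?thesis
      by (simp add: twisted_convolution_algebra_def)
  qed
  interpret star_algebra_iso ?A ?B T "l1_norm X" "l1_norm Y"
  proof
    show "bij_betw T (carrier ?A) (carrier ?B)"
      using ST TS T_in S_in by (intro bij_betw_byWitness[where f' = S]) auto
    show "\<one>\<^bsub>?A\<^esub> \<in> carrier ?A"
      by (rule twisted_convolution_algebra_one_closed)
    show "T \<one>\<^bsub>?A\<^esub> = \<one>\<^bsub>?B\<^esub>"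
      by (auto simp: T_def twisted_convolution_algebra_def fun_eq_iff in_XY)
    fix a b c assume a: "a \<in> carrier ?A"
    show "c \<odot>\<^bsub>?A\<^esub> a \<in> carrier ?A" "adj ?A a \<in> carrier ?A"
      using a \<alpha> by (simp_all add: twisted_convolution_algebra_smult_closed twisted_convolution_algebra_adj_closed)
    show "T (c \<odot>\<^bsub>?A\<^esub> a) = c \<odot>\<^bsub>?B\<^esub> T a"
      by (auto simp: T_def twisted_convolution_algebra_def fun_eq_iff)
    show "T (adj ?A a) = adj ?B (T a)"
      by (auto simp: T_def twisted_convolution_algebra_def fun_eq_iff cfun_action_def in_XY \<beta>)
    show "0 \<le> l1_norm X a"
      using X A(1)[OF a] by (rule l1_norm_nonneg)
    have "(SUP y\<in>topspace Y. cmod (T a n y)) = (SUP x\<in>topspace X. cmod (a n x))" for n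
      unfolding Y image_image by (intro SUP_cong) (auto simp: T_def in_XY inv Y)
    then show "l1_norm Y (T a) = l1_norm X a"
      by (simp add: l1_norm_def supp[OF a])
    assume b: "b \<in> carrier ?A"
    show "a \<otimes>\<^bsub>?A\<^esub> b \<in> carrier ?A" "a \<oplus>\<^bsub>?A\<^esub> b \<in> carrier ?A"
      using a b \<alpha> by (simp_all add: twisted_convolution_algebra_mult_closed twisted_convolution_algebra_add_closed)
    \<comment> \<open>\<open>T a\<close> stays folded at first so that \<open>supp\<close> can
      identify the index sets of the two sums; only then is \<open>T\<close> unfolded.\<close>
    have "T (a \<otimes>\<^bsub>?A\<^esub> b) n y = (T a \<otimes>\<^bsub>?B\<^esub> T b) n y" for n y
      by (cases "y \<in> topspace Y")
        (simp_all add: twisted_convolution_algebra_def supp[OF a], simp_all add: T_def cfun_action_def in_XY \<beta>)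
    then show "T (a \<otimes>\<^bsub>?A\<^esub> b) = T a \<otimes>\<^bsub>?B\<^esub> T b"
      by blast
    show "T (a \<oplus>\<^bsub>?A\<^esub> b) = T a \<oplus>\<^bsub>?B\<^esub> T b"
      by (auto simp: T_def twisted_convolution_algebra_def fun_eq_iff)
    show "(a \<oplus>\<^bsub>?A\<^esub> (- 1) \<odot>\<^bsub>?A\<^esub> b) \<oplus>\<^bsub>?A\<^esub> b = a"
      "(- 1) \<odot>\<^bsub>?A\<^esub> (a \<oplus>\<^bsub>?A\<^esub> (- 1) \<odot>\<^bsub>?A\<^esub> b) = b \<oplus>\<^bsub>?A\<^esub> (- 1) \<odot>\<^bsub>?A\<^esub> a"
      by (simp_all add: twisted_convolution_algebra_def)
  qed
  show ?thesis
    unfolding twisted_crossed_product_def by (rule cstar_isomorphic_enveloping)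
qed

section \<open>Mapping tori that are solenoidal\<close>

text \<open>The assumptions of \<open>equivariant_partitions\<close> have three main sources: finite
  fibres and unique lifting give finite equivariant partitions, injectivity of the bundle
  isomorphism separates points, and its surjectivity makes the refinements strict.\<close>

lemma mapping_torus_solenoidal_imp_odometer:
  fixes X :: "'x topology" and \<alpha> :: "int ^ 'd \<Rightarrow> 'x \<Rightarrow> 'x"
    and f :: "nat \<Rightarrow> (real ^ 'd) set \<Rightarrow> (real ^ 'd) set"
  assumes X: "compact_space X" and nonempty: "topspace X \<noteq> {}"
    and \<alpha>: "zd_action X \<alpha>" and minimal: "minimal_action X \<alpha>"
    and f: "solenoidal_tower f"
    and iso: "bundle_isomorphic (mapping_torus X \<alpha>) mapping_torus_proj
      (solenoidal_torus f) solenoidal_torus_proj"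
  obtains \<Gamma> \<Phi> where "odometer_tower \<Gamma>" "homeomorphic_map X (odometer_space \<Gamma>) \<Phi>"
    "\<And>n x. x \<in> topspace X \<Longrightarrow> \<Phi> (\<alpha> n x) = odometer_action n (\<Phi> x)"
proof -
  obtain h where h: "homeomorphic_map (mapping_torus X \<alpha>) (solenoidal_torus f) h"
    and h0: "\<And>e. e \<in> topspace (mapping_torus X \<alpha>) \<Longrightarrow> h e 0 = mapping_torus_proj e"
    using iso by (auto simp: bundle_isomorphic_def solenoidal_torus_proj_def)
  define R where "R = mapping_torus_rel X \<alpha>"
  define q where "q x u = R `` {(x, u)}" for x and u :: "real ^ 'd"
  \<comment> \<open>For fixed \<open>x\<close>, the map \<open>g j x\<close> lifts the quotient map
    from Euclidean space to the torus through the first \<open>j\<close> covers.\<close>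
  define g where "g j x u = h (q x u) j" for j x u
  define \<phi> where "\<phi> j x = g j x 0" for j x
  have R: "equiv (topspace (prod_topology X euclidean)) R"
    unfolding R_def by (rule equiv_mapping_torus_rel[OF \<alpha>])
  have \<alpha>_in: "\<alpha> n x \<in> topspace X" if "x \<in> topspace X" for n x
    using \<alpha> that by (rule zd_action_in)
  have top_M: "topspace (mapping_torus X \<alpha>) = (topspace X \<times> UNIV) // R"
    using topspace_quotient_topology[OF R] by (simp add: mapping_torus_def R_def)
  have q_in: "q x u \<in> topspace (mapping_torus X \<alpha>)" if "x \<in> topspace X" for x u
    unfolding top_M q_def using that by (intro quotientI) auto
  have q_eq_iff: "q x u = q y v \<longleftrightarrow> ((x, u), (y, v)) \<in> R"
    if "x \<in> topspace X" "y \<in> topspace X" for x y u v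
    unfolding q_def using that by (intro eq_equiv_class_iff[OF R]) auto
  have top_S: "topspace (solenoidal_torus f) = {y. (\<forall>j. y j \<in> topspace torus) \<and> (\<forall>j. f j (y (Suc j)) = y j)}"
    by (auto simp: solenoidal_torus_def inverse_limit_def PiE_iff)
  have h_in: "h (q x u) \<in> topspace (solenoidal_torus f)" if "x \<in> topspace X" for x u
    using homeomorphic_imp_surjective_map[OF h] q_in[OF that] by blast
  have g_in: "g j x u \<in> topspace torus" and f_g: "f j (g (Suc j) x u) = g j x u"
    if "x \<in> topspace X" for j x u
    using h_in[OF that, of u] by (auto simp: top_S g_def)
  have g_0: "g 0 x u = torus_rel `` {u}" if x: "x \<in> topspace X" for x u
  proof -
    have "mapping_torus_proj (q x u) = (\<Union>n. torus_rel `` {u + rvec n})"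
      using x by (auto simp: mapping_torus_proj_def q_def R_def mapping_torus_rel_def)
    also have "\<dots> = torus_rel `` {u}"
      using torus_class_eq_iff[of u] by blast
    finally show ?thesis
      using h0[OF q_in[OF x]] by (simp add: g_def)
  qed
  have q_act: "q x (rvec n) = q (\<alpha> n x) 0" if x: "x \<in> topspace X" for x n
  proof -
    have "\<alpha> (- n) (\<alpha> n x) = x"
      using \<alpha> x by (metis add.left_inverse zd_action_def)
    then have "((\<alpha> n x, 0), (x, rvec n)) \<in> R"
      unfolding R_def mapping_torus_rel_def using \<alpha>_in[OF x] by force
    then show ?thesis
      using q_eq_iff x \<alpha>_in by metis
  qed
  have g_cont: "continuous_map (prod_topology X euclidean) torus (\<lambda>(x, u). g j x u)" for j
  proof -
    have "continuous_map (prod_topology X euclidean) (mapping_torus X \<alpha>) (\<lambda>p. R `` {p})"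
      using continuous_map_quotient_topology[OF R] by (simp add: mapping_torus_def R_def)
    moreover have "continuous_map (mapping_torus X \<alpha>) (product_topology (\<lambda>_. torus) UNIV) h"
      using homeomorphic_imp_continuous_map[OF h]
      by (simp add: solenoidal_torus_def inverse_limit_def continuous_map_in_subtopology)
    moreover have "continuous_map (product_topology (\<lambda>_. torus) UNIV) torus (\<lambda>y. y j)"
      by (rule continuous_map_product_projection) simp
    ultimately have "continuous_map (prod_topology X euclidean) torus ((\<lambda>y. y j) \<circ> (h \<circ> (\<lambda>p. R `` {p})))"
      by (blast intro: continuous_map_compose)
    then show ?thesis
      by (simp add: g_def q_def comp_def case_prod_unfold)
  qed
  have path_cont: "continuous_map euclidean torus (g j x)" if "x \<in> topspace X" for j x
  proof -
    have "continuous_map euclidean (prod_topology X euclidean) (\<lambda>u. (x, u))"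
      using that by (simp add: continuous_map_paired)
    from continuous_map_compose[OF this g_cont[of j]] show ?thesis
      by (simp add: comp_def)
  qed
  have \<phi>_cont: "continuous_map X torus (\<phi> j)" for j
  proof -
    have "continuous_map X (prod_topology X euclidean) (\<lambda>x. (x, 0))"
      by (simp add: continuous_map_paired)
    from continuous_map_compose[OF this g_cont[of j]] show ?thesis
      by (simp add: comp_def \<phi>_def[abs_def])
  qed
  have cover: "covering_map torus torus (f j)"
    and fibre: "\<And>b. b \<in> topspace torus \<Longrightarrow> finite {e \<in> topspace torus. f j e = b} \<and> card {e \<in> topspace torus. f j e = b} > 1" for j
    using f by (auto simp: solenoidal_tower_def finite_nontrivial_galois_cover_def galois_cover_def)
  \<comment> \<open>Induction on the level: both maps at level \<open>Suc j\<close> lift the same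
    map through \<open>f j\<close>, and they agree at \<open>0\<close>.\<close>
  have lift: "g j x u = g j y u" if xy: "x \<in> topspace X" "y \<in> topspace X" and "\<phi> j x = \<phi> j y" for j x y u
    using that(3)
  proof (induction j arbitrary: u)
    case 0
    then show ?case
      by (simp add: g_0 xy)
  next
    case (Suc j)
    then have "\<phi> j x = \<phi> j y"
      using f_g[of _ j 0] xy unfolding \<phi>_def by metis
    then have "g j x w = g j y w" for w
      by (rule Suc.IH)
    then have eq: "f j (g (Suc j) x w) = f j (g (Suc j) y w)" for w
      by (simp add: f_g xy)
    have conn: "connected_space (euclidean :: (real ^ 'd) topology)"
      using connected_UNIV by (simp flip: connectedin_topspace)
    have base: "g (Suc j) x 0 = g (Suc j) y 0"
      using Suc.prems by (simp add: \<phi>_def)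
    show ?case
      by (rule covering_map_unique_lift[OF cover[of j] Hausdorff_space_torus conn
            path_cont[OF xy(1)] path_cont[OF xy(2)] eq _ base]) simp_all
  qed
  have finite_\<phi>: "finite (\<phi> j ` topspace X)" for j
  proof (induction j)
    case 0
    have "\<phi> 0 ` topspace X \<subseteq> {torus_rel `` {0}}"
      by (auto simp: \<phi>_def g_0)
    then show ?case
      by (rule finite_subset) simp
  next
    case (Suc j)
    have "\<phi> (Suc j) ` topspace X \<subseteq> (\<Union>b\<in>\<phi> j ` topspace X. {e \<in> topspace torus. f j e = b})"
      by (auto simp: \<phi>_def f_g g_in)
    moreover have "finite \<dots>"
      using Suc fibre g_in by (intro finite_UN_I) (auto simp: \<phi>_def)
    ultimately show ?case
      by (rule finite_subset)
  qed
  obtain x0 where x0: "x0 \<in> topspace X"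
    using nonempty by blast
  have "equivariant_partitions X \<alpha> \<phi> x0"
  proof
    show "compact_space X" "zd_action X \<alpha>" "minimal_action X \<alpha>" "x0 \<in> topspace X" "finite (\<phi> j ` topspace X)" for j
      using X \<alpha> minimal x0 finite_\<phi> by auto
    show "openin X {x \<in> topspace X. \<phi> j x = c}" for j c
    proof -
      \<comment> \<open>Finite sets are closed in the torus, so the finitely many other pieces have
        a closed union.\<close>
      have "closedin torus (\<phi> j ` topspace X - {c})"
        using Hausdorff_imp_t1_space[OF Hausdorff_space_torus] finite_\<phi>[of j] g_in
        by (auto simp: t1_space_closedin_finite \<phi>_def)
      then have "closedin X {x \<in> topspace X. \<phi> j x \<in> \<phi> j ` topspace X - {c}}"
        by (rule closedin_continuous_map_preimage[OF \<phi>_cont])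
      moreover have "{x \<in> topspace X. \<phi> j x = c} = topspace X - {x \<in> topspace X. \<phi> j x \<in> \<phi> j ` topspace X - {c}}"
        by auto
      ultimately show ?thesis
        by (simp add: openin_diff)
    qed
    fix x y j assume xy: "x \<in> topspace X" "y \<in> topspace X"
    \<comment> \<open>Equal labels give equal lifts, evaluated here at the lattice vector
      \<open>rvec n\<close>, where \<open>q_act\<close> turns the translation into the
      action.\<close>
    show "\<phi> j (\<alpha> n x) = \<phi> j (\<alpha> n y)" if "\<phi> j x = \<phi> j y" for n
      using lift[OF xy that, of "rvec n"] xy by (simp add: \<phi>_def g_def q_act)
    show "\<phi> j x = \<phi> j y" if "\<phi> (Suc j) x = \<phi> (Suc j) y"
      using that f_g[of _ j 0] xy unfolding \<phi>_def by metis
    show "\<phi> 0 x = \<phi> 0 y"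
      using xy by (simp add: \<phi>_def g_0)
    show "x = y" if "\<And>j. \<phi> j x = \<phi> j y"
    proof -
      have "h (q x 0) = h (q y 0)"
        using that by (auto simp: \<phi>_def g_def)
      then have "q x 0 = q y 0"
        using homeomorphic_imp_injective_map[OF h] q_in xy by (auto dest: inj_onD)
      then have "((x, 0), (y, 0)) \<in> R"
        using q_eq_iff[OF xy] by blast
      then obtain n where n: "y = \<alpha> (- n) x" "rvec n = (0 :: real ^ 'd)"
        by (auto simp: R_def mapping_torus_rel_def)
      then have "n = 0"
        by (simp add: rvec_def vec_eq_iff)
      then show ?thesis
        using n(1) \<alpha> xy(1) by (simp add: zd_action_def)
    qed
  next
    fix j
    let ?F = "{e \<in> topspace torus. f j e = \<phi> j x0}"
    \<comment> \<open>The cover has degree greater than one, so the fibre contains a point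
      \<open>z\<close> other than the label of \<open>x0\<close>.\<close>
    have "\<not> ?F \<subseteq> {\<phi> (Suc j) x0}"
      using fibre[of "\<phi> j x0" j] g_in[OF x0] card_mono[of "{\<phi> (Suc j) x0}" ?F] by (auto simp: \<phi>_def)
    then obtain z where z: "z \<in> topspace torus" "f j z = \<phi> j x0" "z \<noteq> \<phi> (Suc j) x0"
      by blast
    \<comment> \<open>\<open>P\<close> steers towards a point of the solenoid agreeing with \<open>h [x\<^sub>0, 0]\<close> up to level \<open>j\<close> but not at level \<open>j + 1\<close>.\<close>
    define P where "P i y \<longleftrightarrow> y \<in> topspace torus \<and> (i \<le> j \<longrightarrow> y = \<phi> i x0) \<and> (i = Suc j \<longrightarrow> y = z)" for i y
    have "\<exists>y. P (Suc i) y \<and> f i y = x" if x: "P i x" for i x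
    proof -
      \<comment> \<open>Follow the labels of \<open>x0\<close> up to level \<open>j\<close>, branch
        off to \<open>z\<close>, and from there lift arbitrarily, as the covers are onto.\<close>
      consider "Suc i \<le> j" | "i = j" | "j < i" by linarith
      then show ?thesis
      proof cases
        case 1
        then show ?thesis
          using x g_in[OF x0] f_g[OF x0] by (intro exI[of _ "\<phi> (Suc i) x0"]) (auto simp: P_def \<phi>_def)
      next
        case 2
        then show ?thesis
          using x z by (intro exI[of _ z]) (auto simp: P_def)
      next
        case 3
        moreover have "x \<in> f i ` topspace torus"
          using x cover[of i] by (auto simp: P_def covering_map_def)
        ultimately show ?thesis
          by (auto simp: P_def)
      qed
    qed
    moreover have "\<exists>y. P 0 y"
      using g_in[OF x0] by (intro exI[of _ "\<phi> 0 x0"]) (auto simp: P_def \<phi>_def)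
    ultimately obtain w where w: "\<And>i. P i (w i)" "\<And>i. f i (w (Suc i)) = w i"
      using dependent_nat_choice[of P "\<lambda>i x y. f i y = x"] by metis
    have "w \<in> topspace (solenoidal_torus f)"
      using w by (auto simp: top_S P_def)
    then obtain e where e: "e \<in> topspace (mapping_torus X \<alpha>)" "w = h e"
      using homeomorphic_imp_surjective_map[OF h] by blast
    then obtain x u where x: "x \<in> topspace X" "e = q x u"
      by (auto simp: top_M q_def elim!: quotientE)
    \<comment> \<open>\<open>P 0\<close> fixes the base coordinate at the class of the origin, so
      \<open>u\<close> is integral and the preimage of \<open>w\<close> is also represented by
      \<open>\<alpha> n x\<close> over the origin.\<close>
    have "torus_rel `` {0} = torus_rel `` {u}"
      using w(1)[of 0] e x x0 g_0 by (auto simp: P_def \<phi>_def g_def)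
    then obtain n where "u = rvec n"
      using torus_class_eq_iff[of 0 u] by auto
    then have "\<phi> i (\<alpha> n x) = w i" for i
      using e x by (simp add: \<phi>_def g_def q_act)
    then show "\<exists>x\<in>topspace X. \<phi> j x = \<phi> j x0 \<and> \<phi> (Suc j) x \<noteq> \<phi> (Suc j) x0"
      using w(1)[of j] w(1)[of "Suc j"] z(3) \<alpha>_in[OF x(1), of n] by (intro bexI[of _ "\<alpha> n x"]) (auto simp: P_def)
  qed
  then interpret equivariant_partitions X \<alpha> \<phi> x0 .
  show thesis
    using that[OF odometer_tower_visits homeomorphic_map_visits odometer_action_visits] .
qed

lemma cantor_space_compact_nonempty:
  assumes "cantor_space X"
  shows "compact_space X" "topspace X \<noteq> {}"
proof -
  let ?C = "product_topology (\<lambda>_::nat. discrete_topology (UNIV :: bool set)) UNIV"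
  have "compact_space ?C"
    by (simp add: compact_space_product_topology compact_space_discrete_topology)
  then show "compact_space X"
    using assms homeomorphic_compact_space by (auto simp: cantor_space_def)
  obtain g where "homeomorphic_map X ?C g"
    using assms by (auto simp: cantor_space_def homeomorphic_space)
  then have "g ` topspace X = UNIV"
    using homeomorphic_imp_surjective_map by fastforce
  then show "topspace X \<noteq> {}"
    by auto
qed

theorem corollary4:
  fixes X :: "'x topology"
    and \<alpha> :: "int ^ 'd \<Rightarrow> 'x \<Rightarrow> 'x"
    and \<Theta> :: "real ^ 'd ^ 'd"
  assumes "cantor_space X"
    and "zd_action X \<alpha>"
    and "free_action X \<alpha>"
    and "minimal_action X \<alpha>"
    and "\<exists>f :: nat \<Rightarrow> (real ^ 'd) set \<Rightarrow> (real ^ 'd) set. solenoidal_tower f \<and>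
           bundle_isomorphic (mapping_torus X \<alpha>) mapping_torus_proj
             (solenoidal_torus f) solenoidal_torus_proj"
    and "transpose \<Theta> = - \<Theta>"
  shows "(\<exists>\<Gamma> :: nat \<Rightarrow> (int ^ 'd) set. odometer_tower \<Gamma> \<and>
            cstar_isomorphic
              (twisted_crossed_product X \<alpha> (theta_cocycle \<Theta>))
              (twisted_crossed_product (odometer_space \<Gamma>) odometer_action (theta_cocycle \<Theta>))) \<and>
         (\<exists>\<Gamma> :: nat \<Rightarrow> (int ^ 'd) set. odometer_tower \<Gamma> \<and>
            cstar_isomorphic
              (crossed_product X \<alpha>)
              (crossed_product (odometer_space \<Gamma>) odometer_action))"
proof -
  note X = cantor_space_compact_nonempty[OF assms(1)]
  obtain f :: "nat \<Rightarrow> (real ^ 'd) set \<Rightarrow> (real ^ 'd) set" where "solenoidal_tower f"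
    "bundle_isomorphic (mapping_torus X \<alpha>) mapping_torus_proj (solenoidal_torus f) solenoidal_torus_proj"
    using assms(5) by blast
  then obtain \<Gamma> \<Phi> where \<Gamma>: "odometer_tower \<Gamma>" and \<Phi>: "homeomorphic_map X (odometer_space \<Gamma>) \<Phi>"
    "\<And>n x. x \<in> topspace X \<Longrightarrow> \<Phi> (\<alpha> n x) = odometer_action n (\<Phi> x)"
    using mapping_torus_solenoidal_imp_odometer[OF X assms(2,4)] by blast
  \<comment> \<open>The twist is left arbitrary, so a single tower serves both claims; the constant
    cocycle \<open>1\<close> gives the untwisted one.\<close>
  have "cstar_isomorphic (twisted_crossed_product X \<alpha> \<sigma>)
      (twisted_crossed_product (odometer_space \<Gamma>) odometer_action \<sigma>)" for \<sigma>
    using X(1) assms(2) \<Phi> by (rule cstar_isomorphic_conjugate_actions)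
  then show ?thesis
    using \<Gamma> unfolding crossed_product_def by blast
qed

end
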